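(* Let $H\in\mathbb{C}^{n\times n}$ be an invertible Hermitian matrix and let $B\in\mathbb{C}^{n\times n}$ be an $H$-nonnegative matrix with $\sigma(B)\subset[0,\infty)$ such that $(B,H)$ is in canonical form $$B=\bigoplus_{i=1}^qJ_1(\lambda_i)\oplus\bigoplus_{i=1}^sJ_1(0)\oplus\bigoplus_{i=1}^tJ_2(0),\qquad H=\bigoplus_{i=1}^qQ_1\oplus\bigoplus_{i=1}^s\varepsilon_iQ_1\oplus\bigoplus_{i=1}^tQ_2,$$ with $\lambda_i>0$, $\varepsilon_i=\pm1$, and assume $s_+\ge t$, where $s_+$ is the number of $i$ with $\varepsilon_i=1$. Let $A$ be an $H$-selfadjoint square root of $B$. Then there is a Segre pairing $\mathcal{S}$ of $B$, with $\ell_1$ pairs $(1,0)$, $\ell_2$ pairs $(1,1)$, $\ell_3$ pairs $(2,1)$ and no other pairs, such that, after a suitable renumbering of $\lambda_1,\ldots,\lambda_q$, the canonical form of the pair $(A,H)$ is $$S^{-1}AS=\bigoplus_{i=1}^{q_1}J_1(\sqrt{\lambda_i})\oplus\bigoplus_{i=1}^{q_2}J_1(-\sqrt{\lambda_{q_1+i}})\oplus\bigoplus_{i=1}^{\ell_1}J_1(0)\oplus\bigoplus_{i=1}^{\ell_2}J_2(0)\oplus\bigoplus_{i=1}^{\ell_3}J_3(0),$$ $$S^*HS=\bigoplus_{i=1}^{q_1}Q_1\oplus\bigoplus_{i=1}^{q_2}Q_1\oplus\bigoplus_{i=1}^{\ell_1}\zeta_iQ_1\oplus\bigoplus_{i=1}^{\ell_2}\eta_iQ_2\oplus\bigoplus_{i=1}^{\ell_3}Q_3,$$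 for some invertible matrix $S$, where $q_1+q_2=q$, $\eta_i=\pm1$, and $\zeta_i$ is equal to the sign characteristic of the corresponding block $J_1(0)$ in $B$ (that is, $\zeta_i=\varepsilon_{\iota(i)}$ for some injective map $\iota:\{1,\ldots,\ell_1\}\to\{1,\ldots,s\}$, with $\iota(i)$ the index of the block of $B$ corresponding to the $i$-th pair $(1,0)$).
   Context: With $(\cdot,\cdot)$ the Euclidean inner product on $\mathbb{C}^n$ and $[x,y]=(Hx,y)$: a matrix $B$ is $H$-nonnegative if $[Bx,x]\ge 0$ for all $x\in\mathbb{C}^n$, and $A$ is $H$-selfadjoint if $HA=A^*H$. A square root of $B$ is a complex matrix $A$ with $A^2=B$. $J_k(\lambda)$ is the $k\times k$ Jordan block with eigenvalue $\lambda$; $Q_k$ is the $k\times k$ matrix with ones on the main anti-diagonal and zeros elsewhere. Canonical form of a pair $(A,H)$ with $A$ $H$-selfadjoint and real spectrum: there is an invertible $S$ with $S^{-1}AS=\bigoplus_jJ_{k_j}(\mu_j)$ and $S^*HS=\bigoplus_j\theta_jQ_{k_j}$, $\theta_j=\pm1$ (the sign characteristic); it is unique up to simultaneous permutation of blocks. Let $(n_1,\ldots,n_p)$ be the list of sizes of the Jordan blocks of $B$ at eigenvalue $0$ in decreasing order. A Segre pairing of $B$ is a finite collection (with repetitions allowed, arranged lexicographically) of pairs of numbers from $\{n_1,\ldots,n_p\}\cup\{0\}$ such that: each entry $n_i$ (counted with multiplicity) appears in one and only one pair; each pair consists either of two of these entries or of one entry and one zero, with first entry greater than or equal to the second; and the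 absolute difference between the two entries of each pair is at most one. *)

theory Defs
  imports
    "Jordan_Normal_Form.Spectral_Radius"
    "Jordan_Normal_Form.Jordan_Normal_Form_Uniqueness"
    "HOL-Library.Multiset"
begin

definition hermitian_mat :: "complex mat \<Rightarrow> bool" where
  "hermitian_mat H \<longleftrightarrow> mat_adjoint H = H"

definition indef_prod :: "complex mat \<Rightarrow> complex vec \<Rightarrow> complex vec \<Rightarrow> complex" where
  "indef_prod H x y = (H *\<^sub>v x) \<bullet>c y"

(* The order on complex numbers is the componentwise one of Complex_Order: 0 \<le> z means that z is
   real and nonnegative. *)
definition H_nonnegative :: "nat \<Rightarrow> complex mat \<Rightarrow> complex mat \<Rightarrow> bool" where
  "H_nonnegative n H B \<longleftrightarrow> (\<forall>x \<in> carrier_vec n. 0 \<le> indef_prod H (B *\<^sub>v x) x)"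

definition H_selfadjoint :: "complex mat \<Rightarrow> complex mat \<Rightarrow> bool" where
  "H_selfadjoint H A \<longleftrightarrow> H * A = mat_adjoint A * H"

(* Indices start at 0, so the main anti-diagonal is i + j = k - 1. *)
definition sip_mat :: "nat \<Rightarrow> complex mat" where
  "sip_mat k = mat k k (\<lambda>(i, j). if i + j + 1 = k then 1 else 0)"

(* A Segre pairing is an unordered collection with repetitions (listing it lexicographically is only
   a normalization), hence a multiset of pairs.  The sizes of the Jordan blocks at 0 are read off from
   any Jordan normal form of B, which is unique up to the order of the blocks; block sizes in jordan_nf
   are positive.  Since the first entry of each pair is nonzero, each pair consists of two block sizes
   or of one block size and one zero; the equation between multisets says that every block size,
   counted with multiplicity, is used exactly once. *)
definition segre_pairing :: "complex mat \<Rightarrow> (nat \<times> nat) multiset \<Rightarrow> bool" where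
  "segre_pairing B P \<longleftrightarrow>
     (\<exists>n_as. jordan_nf B n_as \<and>
        filter_mset (\<lambda>k. k \<noteq> 0) (image_mset fst P + image_mset snd P) =
          mset (map fst (filter (\<lambda>(k, a). a = 0) n_as))) \<and>
     (\<forall>(a, b) \<in># P. 0 < a \<and> b \<le> a \<and> a - b \<le> 1)"

end

theory Submission
  imports Defs "HOL-Combinatorics.Permutations"
begin

text \<open>
  A square root \<open>A\<close> commutes with \<open>B\<close>.  The part of \<open>B\<close> with positive eigenvalues is an invertible
  diagonal matrix and the part at \<open>0\<close> has square zero, so \<open>A\<close> is a direct sum of a root \<open>A\<^sub>+\<close> of the
  first and a root \<open>A\<^sub>0\<close> of the second (\<open>commutant_block_diagonal\<close>), and the two can be treated
  separately.

  On the positive part the form is the standard inner product, so \<open>A\<^sub>+\<close> is Hermitian and has an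
  orthonormal eigenbasis; its eigenvalues are \<open>\<plusminus>\<surd>\<lambda>\<^sub>i\<close> because \<open>A\<^sub>+\<^sup>2\<close> is diagonal with entries
  \<open>\<lambda>\<^sub>i\<close> (\<open>positive_part\<close>).

  On the part at \<open>0\<close> one has \<open>A\<^sub>0\<^sup>4 = 0\<close>.  Nonnegativity makes \<open>[A\<^sup>2x, x]\<close> a semidefinite form, whose
  isotropic vectors are in its kernel.  For \<open>x = A\<^sub>0 w\<close> the value is \<open>[A\<^sub>0\<^sup>4w, w] = 0\<close>, hence
  \<open>A\<^sub>0\<^sup>3 = 0\<close>; this is what excludes blocks of size \<open>4\<close>.  A vector \<open>w\<close> with \<open>A\<^sub>0\<^sup>2w \<noteq> 0\<close> has
  \<open>[A\<^sub>0\<^sup>2w, w] > 0\<close>, so it generates a block of size \<open>3\<close> with positive sign.  After all of these are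
  split off, \<open>A\<^sub>0\<^sup>2\<close> vanishes on the orthogonal complement, where blocks of size \<open>2\<close> and then of size
  \<open>1\<close>, with arbitrary signs, can be split off in the same manner (\<open>nilpotent_canonical\<close>).

  The numbers of blocks follow from the dimensions of the kernels: \<open>ker A\<^sub>0\<^sup>2 = ker B\<^sub>0\<close> and the size of
  the space give \<open>\<ell>\<^sub>3 = t\<close> and \<open>\<ell>\<^sub>1 + 2\<ell>\<^sub>2 + \<ell>\<^sub>3 = s\<close>, which says that the pairs form a Segre pairing.
  The signs of the blocks of size \<open>1\<close> come from an inertia argument: their generators are in
  \<open>ker B\<^sub>0\<close>, on which the form is \<open>\<Sum>\<epsilon>\<^sub>j |z\<^sub>j|\<^sup>2\<close> (\<open>form_on_kernel\<close>), so there are at most as many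
  of each sign as there are among the \<open>\<epsilon>\<^sub>j\<close> (\<open>inertia_injection\<close>).
\<close>

section \<open>Adjoints and block matrices\<close>

lemma adjoint_carrier [simp]:
  "A \<in> carrier_mat m n \<Longrightarrow> mat_adjoint A \<in> carrier_mat n m"
  by (auto simp: mat_adjoint_def)

lemma adjoint_dim [simp]:
  "dim_row (mat_adjoint A) = dim_col A" "dim_col (mat_adjoint A) = dim_row A"
  by (auto simp: mat_adjoint_def)

lemma adjoint_index [simp]:
  "i < dim_col A \<Longrightarrow> j < dim_row A \<Longrightarrow> mat_adjoint A $$ (i, j) = conjugate (A $$ (j, i))"
  by (simp add: mat_adjoint_def mat_of_rows_index)

lemma adjoint_adjoint [simp]: "mat_adjoint (mat_adjoint A) = A"
  by (rule eq_matI) auto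

lemma adjoint_zero [simp]: "mat_adjoint (0\<^sub>m m n :: complex mat) = 0\<^sub>m n m"
  by (rule eq_matI) auto

lemma adjoint_one [simp]: "mat_adjoint (1\<^sub>m n :: complex mat) = 1\<^sub>m n"
  by (rule eq_matI) auto

lemma adjoint_four_block:
  fixes A :: "complex mat"
  assumes "A \<in> carrier_mat a b" "B \<in> carrier_mat a d" "C \<in> carrier_mat c b" "D \<in> carrier_mat c d"
  shows "mat_adjoint (four_block_mat A B C D)
    = four_block_mat (mat_adjoint A) (mat_adjoint C) (mat_adjoint B) (mat_adjoint D)"
  by (rule eq_matI) (use assms in auto)

lemma adjoint_vec:
  fixes A :: "complex mat"
  assumes "A \<in> carrier_mat m n" "x \<in> carrier_vec n" "y \<in> carrier_vec m"
  shows "(A *\<^sub>v x) \<bullet>c y = x \<bullet>c (mat_adjoint A *\<^sub>v y)"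
proof -
  have "(A *\<^sub>v x) \<bullet>c y = (\<Sum>i<m. \<Sum>j<n. A $$ (i,j) * x $ j * cnj (y $ i))"
    using assms by (simp add: scalar_prod_def sum_distrib_right atLeast0LessThan)
  also have "\<dots> = (\<Sum>j<n. \<Sum>i<m. A $$ (i,j) * x $ j * cnj (y $ i))"
    by (rule sum.swap)
  also have "\<dots> = x \<bullet>c (mat_adjoint A *\<^sub>v y)"
    using assms by (simp add: scalar_prod_def sum_distrib_left atLeast0LessThan mult.assoc mult.left_commute)
  finally show ?thesis .
qed

lemma block_diag_mult:
  fixes X Y :: "complex mat"
  assumes "X \<in> carrier_mat a a" "Y \<in> carrier_mat a a" "X' \<in> carrier_mat b b" "Y' \<in> carrier_mat b b"
  shows "four_block_mat X (0\<^sub>m a b) (0\<^sub>m b a) X' * four_block_mat Y (0\<^sub>m a b) (0\<^sub>m b a) Y'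
    = four_block_mat (X * Y) (0\<^sub>m a b) (0\<^sub>m b a) (X' * Y')"
  using assms by (subst mult_four_block_mat[of _ a a _ b _ b _ _ a _ b]) auto

lemma block_diag_adjoint:
  fixes X :: "complex mat"
  assumes "X \<in> carrier_mat a a" "X' \<in> carrier_mat b b"
  shows "mat_adjoint (four_block_mat X (0\<^sub>m a b) (0\<^sub>m b a) X')
    = four_block_mat (mat_adjoint X) (0\<^sub>m a b) (0\<^sub>m b a) (mat_adjoint X')"
  using assms by (subst adjoint_four_block[of _ a a _ b _ b]) auto

lemma block_diag_vec:
  fixes X :: "complex mat"
  assumes "X \<in> carrier_mat a a" "X' \<in> carrier_mat b b" "x \<in> carrier_vec a" "y \<in> carrier_vec b"
  shows "four_block_mat X (0\<^sub>m a b) (0\<^sub>m b a) X' *\<^sub>v (x @\<^sub>v y) = (X *\<^sub>v x) @\<^sub>v (X' *\<^sub>v y)"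
proof -
  have "0\<^sub>m a b *\<^sub>v y = 0\<^sub>v a" "0\<^sub>m b a *\<^sub>v x = 0\<^sub>v b"
    using assms by (auto intro!: eq_vecI)
  then show ?thesis
    using assms by (subst four_block_mat_mult_vec[of _ a a _ b _ b]) auto
qed

lemma cscalar_append:
  fixes x y :: "complex vec"
  assumes "x \<in> carrier_vec a" "x' \<in> carrier_vec a" "y \<in> carrier_vec b" "y' \<in> carrier_vec b"
  shows "(x @\<^sub>v y) \<bullet>c (x' @\<^sub>v y') = x \<bullet>c x' + y \<bullet>c y'"
proof -
  have "conjugate (x' @\<^sub>v y') = conjugate x' @\<^sub>v conjugate y'"
    using assms by (intro eq_vecI) (auto)
  then show ?thesis using assms by (simp add: scalar_prod_append[of _ a _ b])
qed

lemma four_block_inject: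
  assumes "A1 \<in> carrier_mat a b" "A2 \<in> carrier_mat a d" "A3 \<in> carrier_mat c b" "A4 \<in> carrier_mat c d"
    "B1 \<in> carrier_mat a b" "B2 \<in> carrier_mat a d" "B3 \<in> carrier_mat c b" "B4 \<in> carrier_mat c d"
    and eq: "four_block_mat A1 A2 A3 A4 = four_block_mat B1 B2 B3 B4"
  shows "A1 = B1" "A2 = B2" "A3 = B3" "A4 = B4"
proof -
  have e: "four_block_mat A1 A2 A3 A4 $$ (i, j) = four_block_mat B1 B2 B3 B4 $$ (i, j)" for i j
    using eq by simp
  show "A1 = B1"
  proof (rule eq_matI)
    fix i j assume "i < dim_row B1" "j < dim_col B1"
    then show "A1 $$ (i, j) = B1 $$ (i, j)" using e[of i j] assms(1-8) by simp
  qed (use assms(1-8) in auto)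
  show "A2 = B2"
  proof (rule eq_matI)
    fix i j assume "i < dim_row B2" "j < dim_col B2"
    then show "A2 $$ (i, j) = B2 $$ (i, j)" using e[of i "b + j"] assms(1-8) by simp
  qed (use assms(1-8) in auto)
  show "A3 = B3"
  proof (rule eq_matI)
    fix i j assume "i < dim_row B3" "j < dim_col B3"
    then show "A3 $$ (i, j) = B3 $$ (i, j)" using e[of "a + i" j] assms(1-8) by simp
  qed (use assms(1-8) in auto)
  show "A4 = B4"
  proof (rule eq_matI)
    fix i j assume "i < dim_row B4" "j < dim_col B4"
    then show "A4 $$ (i, j) = B4 $$ (i, j)" using e[of "a + i" "b + j"] assms(1-8) by simp
  qed (use assms(1-8) in auto)
qed

lemma mult_mat_vec_null: "M \<in> carrier_mat m n \<Longrightarrow> M *\<^sub>v 0\<^sub>v n = (0\<^sub>v m :: complex vec)"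
  by (intro eq_vecI) auto

lemma mult_mat_vec_neg:
  "M \<in> carrier_mat m n \<Longrightarrow> v \<in> carrier_vec n \<Longrightarrow> M *\<^sub>v (- v) = - (M *\<^sub>v (v :: complex vec))"
  by (intro eq_vecI) (auto simp: scalar_prod_def sum_negf)

lemma one_smult: "(1::complex) \<cdot>\<^sub>m M = M"
  by (rule eq_matI) auto

section \<open>Underdetermined systems and inertia\<close>

text \<open>Padding the system with zero equations makes it square with determinant \<open>0\<close>.\<close>

lemma underdetermined_mat:
  fixes M :: "complex mat"
  assumes M: "M \<in> carrier_mat r p" and "r < p"
  shows "\<exists>v \<in> carrier_vec p. v \<noteq> 0\<^sub>v p \<and> M *\<^sub>v v = 0\<^sub>v r"
proof -
  define N where "N = mat p p (\<lambda>(i, j). if i < r then M $$ (i, j) else 0)"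
  have N: "N \<in> carrier_mat p p" by (simp add: N_def)
  have "transpose_mat N *\<^sub>v unit_vec p (p - 1) = 0\<^sub>v p"
    using \<open>r < p\<close> by (intro eq_vecI) (auto simp: N_def)
  moreover have "unit_vec p (p - 1) $ (p - 1) \<noteq> (0\<^sub>v p :: complex vec) $ (p - 1)"
    using \<open>r < p\<close> by simp
  then have "unit_vec p (p - 1) \<noteq> (0\<^sub>v p :: complex vec)" by (rule contrapos_nn) (rule arg_cong)
  moreover have "transpose_mat N \<in> carrier_mat p p" using N by simp
  ultimately have "det (transpose_mat N) = 0"
    using det_0_iff_vec_prod_zero_field unit_vec_carrier by blast
  then have "det N = 0" using det_transpose[OF N] by simp
  then obtain v where v: "v \<in> carrier_vec p" "v \<noteq> 0\<^sub>v p" "N *\<^sub>v v = 0\<^sub>v p"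
    using det_0_iff_vec_prod_zero_field[OF N] by blast
  have "M *\<^sub>v v = 0\<^sub>v r"
  proof (rule eq_vecI)
    fix i assume "i < dim_vec (0\<^sub>v r :: complex vec)"
    then have i: "i < r" by simp
    then have "row M i = row N i" using M \<open>r < p\<close> by (auto simp: N_def intro!: eq_vecI)
    then have "(M *\<^sub>v v) $ i = (N *\<^sub>v v) $ i" using i M N \<open>r < p\<close> by simp
    then show "(M *\<^sub>v v) $ i = 0\<^sub>v r $ i" using v(3) i \<open>r < p\<close> by simp
  qed (use M in auto)
  with v show ?thesis by blast
qed

text \<open>The same fact for arbitrary finite index sets, in the form in which it serves the inertia
  argument.\<close>

lemma underdetermined:
  fixes X :: "'i \<Rightarrow> 'j \<Rightarrow> complex"
  assumes "finite I" "finite J" "card J < card I"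
  obtains v where "\<exists>i\<in>I. v i \<noteq> 0" "\<And>j. j \<in> J \<Longrightarrow> (\<Sum>i\<in>I. v i * X i j) = 0"
proof -
  let ?p = "card I" and ?r = "card J"
  obtain f where f: "bij_betw f {0..<?p} I" using ex_bij_betw_nat_finite[OF assms(1)] by blast
  obtain g where g: "bij_betw g {0..<?r} J" using ex_bij_betw_nat_finite[OF assms(2)] by blast
  define M where "M = mat ?r ?p (\<lambda>(b, a). X (f a) (g b))"
  have M: "M \<in> carrier_mat ?r ?p" by (simp add: M_def)
  from underdetermined_mat[OF M assms(3)] obtain v
    where v: "v \<in> carrier_vec ?p" "v \<noteq> 0\<^sub>v ?p" "M *\<^sub>v v = 0\<^sub>v ?r" by auto
  define f' where "f' = the_inv_into {0..<?p} f"
  define u where "u = (\<lambda>i. v $ f' i)"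
  have uf: "u (f a) = v $ a" if "a < ?p" for a
    using f that unfolding u_def f'_def bij_betw_def by (simp add: the_inv_into_f_f)
  show thesis
  proof
    have "\<exists>a<?p. v $ a \<noteq> 0"
    proof (rule ccontr)
      assume "\<not> ?thesis"
      then have "v = 0\<^sub>v ?p" using v(1) by (intro eq_vecI) auto
      with v(2) show False by simp
    qed
    then obtain a where a: "a < ?p" "v $ a \<noteq> 0" by blast
    then show "\<exists>i\<in>I. u i \<noteq> 0" using uf f by (metis atLeastLessThan_iff bij_betwE zero_le)
  next
    fix j assume "j \<in> J"
    then obtain b where b: "b < ?r" "g b = j" using g by (metis atLeastLessThan_iff bij_betw_iff_bijections)
    have "(\<Sum>i\<in>I. u i * X i j) = (\<Sum>a\<in>{0..<?p}. u (f a) * X (f a) j)"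
      by (rule sum.reindex_bij_betw[OF f, symmetric])
    also have "\<dots> = (\<Sum>a\<in>{0..<?p}. v $ a * X (f a) j)"
      by (rule sum.cong) (auto simp: uf)
    also have "\<dots> = (M *\<^sub>v v) $ b"
      using v(1) b by (simp add: M_def scalar_prod_def mult.commute)
    also have "\<dots> = 0" using v(3) b by simp
    finally show "(\<Sum>i\<in>I. u i * X i j) = 0" .
  qed
qed

text \<open>This is the inequality half of Sylvester's law of inertia.  The rows of \<open>X\<close> are orthonormal for the
  form with diagonal \<open>eps\<close>.  If there were more rows than positive coordinates, then some nontrivial
  combination of rows would vanish in every positive coordinate; its square would be both positive
  and at most zero.\<close>

lemma inertia_pos:
  fixes X :: "'i \<Rightarrow> 'j \<Rightarrow> complex"
  assumes fin: "finite I" "finite J"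
    and eps: "\<And>j. j \<in> J \<Longrightarrow> eps j = 1 \<or> eps j = -1"
    and gram: "\<And>i i'. i \<in> I \<Longrightarrow> i' \<in> I \<Longrightarrow>
      (\<Sum>j\<in>J. eps j * X i j * cnj (X i' j)) = (if i = i' then 1 else 0)"
  shows "card I \<le> card {j \<in> J. eps j = 1}"
proof (rule ccontr)
  assume "\<not> ?thesis"
  then have less: "card {j \<in> J. eps j = 1} < card I" by simp
  have "finite {j \<in> J. eps j = 1}" using fin by simp
  from underdetermined[OF fin(1) this less, of X]
  obtain v where v: "\<exists>i\<in>I. v i \<noteq> 0"
    and z: "\<And>j. j \<in> {j \<in> J. eps j = 1} \<Longrightarrow> (\<Sum>i\<in>I. v i * X i j) = 0" by blast
  define y where "y = (\<lambda>j. \<Sum>i\<in>I. v i * X i j)"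
  have "(\<Sum>j\<in>J. eps j * y j * cnj (y j))
    = (\<Sum>j\<in>J. \<Sum>i\<in>I. \<Sum>i'\<in>I. v i * cnj (v i') * (eps j * X i j * cnj (X i' j)))"
    unfolding y_def
    by (simp add: sum_distrib_left sum_distrib_right mult_ac)
  also have "\<dots> = (\<Sum>i\<in>I. \<Sum>i'\<in>I. v i * cnj (v i') * (\<Sum>j\<in>J. eps j * X i j * cnj (X i' j)))"
  proof -
    have "(\<Sum>j\<in>J. \<Sum>i\<in>I. \<Sum>i'\<in>I. F j i i') = (\<Sum>i\<in>I. \<Sum>i'\<in>I. \<Sum>j\<in>J. F j i i')"
      for F :: "'j \<Rightarrow> 'i \<Rightarrow> 'i \<Rightarrow> complex"
      by (subst sum.swap, rule sum.cong[OF refl], rule sum.swap)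
    then show ?thesis by (simp add: sum_distrib_left)
  qed
  also have "\<dots> = (\<Sum>i\<in>I. \<Sum>i'\<in>I. if i = i' then v i * cnj (v i') else 0)"
    by (intro sum.cong refl) (simp add: gram)
  also have "\<dots> = (\<Sum>i\<in>I. v i * cnj (v i))"
    using fin by simp
  finally have eq: "(\<Sum>j\<in>J. eps j * y j * cnj (y j)) = complex_of_real (\<Sum>i\<in>I. (cmod (v i))\<^sup>2)"
    by (simp only: complex_norm_square[symmetric] of_real_sum of_real_power)
  have "(\<Sum>j\<in>J. eps j * y j * cnj (y j)) = (\<Sum>j\<in>J. complex_of_real (- (cmod (y j))\<^sup>2))"
  proof (rule sum.cong[OF refl])
    fix j assume j: "j \<in> J"
    show "eps j * y j * cnj (y j) = complex_of_real (- (cmod (y j))\<^sup>2)"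
    proof (cases "eps j = 1")
      case True
      then have "y j = 0" using z[of j] j by (simp add: y_def)
      then show ?thesis by simp
    next
      case False
      then have "eps j = -1" using eps[OF j] by simp
      then show ?thesis using complex_norm_square[of "y j"] by simp
    qed
  qed
  then have "(\<Sum>i\<in>I. (cmod (v i))\<^sup>2) = (\<Sum>j\<in>J. - (cmod (y j))\<^sup>2)"
    using eq by (metis of_real_eq_iff of_real_sum)
  moreover have "(\<Sum>j\<in>J. - (cmod (y j))\<^sup>2) \<le> 0" by (rule sum_nonpos) simp
  moreover have "(\<Sum>i\<in>I. (cmod (v i))\<^sup>2) > 0"
    using v fin by (auto intro!: sum_pos2)
  ultimately show False by simp
qed

text \<open>Applying the inequality to \<open>eps\<close> and to \<open>-eps\<close> bounds the number of indices of each sign, and the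
  injections for the two signs are glued together.\<close>

lemma inertia_injection:
  fixes X :: "'i \<Rightarrow> 'j \<Rightarrow> complex"
  assumes fin: "finite I" "finite J"
    and eps: "\<And>j. j \<in> J \<Longrightarrow> eps j = 1 \<or> eps j = -1"
    and zeta: "\<And>i. i \<in> I \<Longrightarrow> zeta i = 1 \<or> zeta i = -1"
    and gram: "\<And>i i'. i \<in> I \<Longrightarrow> i' \<in> I \<Longrightarrow>
      (\<Sum>j\<in>J. eps j * X i j * cnj (X i' j)) = (if i = i' then zeta i else 0)"
  obtains \<iota> where "inj_on \<iota> I" "\<iota> ` I \<subseteq> J" "\<And>i. i \<in> I \<Longrightarrow> zeta i = (eps (\<iota> i) :: complex)"
proof -
  have le: "card {i \<in> I. zeta i = \<theta>} \<le> card {j \<in> J. eps j = \<theta>}" if \<theta>: "\<theta> = 1 \<or> \<theta> = -1" for \<theta>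
  proof -
    have "card {i \<in> I. zeta i = \<theta>} \<le> card {j \<in> J. \<theta> * eps j = 1}"
    proof (rule inertia_pos[where X = X])
      fix i i' assume i: "i \<in> {i \<in> I. zeta i = \<theta>}" "i' \<in> {i \<in> I. zeta i = \<theta>}"
      have "(\<Sum>j\<in>J. \<theta> * eps j * X i j * cnj (X i' j)) = \<theta> * (if i = i' then zeta i else 0)"
        using i by (subst gram[symmetric]) (auto simp: sum_distrib_left mult_ac)
      then show "(\<Sum>j\<in>J. \<theta> * eps j * X i j * cnj (X i' j)) = (if i = i' then 1 else 0)"
        using i \<theta> by auto
    next
      fix j assume "j \<in> J"
      with eps[of j] \<theta> show "\<theta> * eps j = 1 \<or> \<theta> * eps j = - 1" by auto
    qed (use fin in auto)
    also have "{j \<in> J. \<theta> * eps j = 1} = {j \<in> J. eps j = \<theta>}"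
      using \<theta> eps by fastforce
    finally show ?thesis .
  qed
  have "\<forall>\<theta>\<in>{1, -1}. \<exists>f. f ` {i \<in> I. zeta i = \<theta>} \<subseteq> {j \<in> J. eps j = \<theta>} \<and> inj_on f {i \<in> I. zeta i = \<theta>}"
    using card_le_inj[OF _ _ le] fin by simp
  from bchoice[OF this] obtain f where f: "\<And>\<theta>. \<theta> = 1 \<or> \<theta> = -1 \<Longrightarrow>
      f \<theta> ` {i \<in> I. zeta i = \<theta>} \<subseteq> {j \<in> J. eps j = \<theta>} \<and> inj_on (f \<theta>) {i \<in> I. zeta i = \<theta>}"
    by blast
  define \<iota> where "\<iota> = (\<lambda>i. f (zeta i) i)"
  have mem: "\<iota> i \<in> J \<and> eps (\<iota> i) = zeta i" if "i \<in> I" for i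
    using f[OF zeta[OF that]] that unfolding \<iota>_def by blast
  show thesis
  proof
    show "inj_on \<iota> I"
    proof (rule inj_onI)
      fix i i' assume i: "i \<in> I" "i' \<in> I" "\<iota> i = \<iota> i'"
      have eq: "zeta i = zeta i'" using mem[OF i(1)] mem[OF i(2)] i(3) by simp
      have "inj_on (f (zeta i)) {i' \<in> I. zeta i' = zeta i}" using f[OF zeta[OF i(1)]] by blast
      moreover have "f (zeta i) i = f (zeta i) i'" using i(3) eq by (simp add: \<iota>_def)
      moreover have "i \<in> {i' \<in> I. zeta i' = zeta i}" "i' \<in> {i' \<in> I. zeta i' = zeta i}"
        using i eq by auto
      ultimately show "i = i'" by (rule inj_onD)
    qed
  qed (use mem in auto)
qed

section \<open>Direct sums of Jordan blocks and of signed anti-diagonal blocks\<close>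

text \<open>A block \<open>(a, k, \<theta>)\<close> stands for the Jordan block of size \<open>k\<close> at \<open>a\<close> with sign characteristic
  \<open>\<theta>\<close>.\<close>

type_synonym block = "complex \<times> nat \<times> complex"

definition jblocks :: "block list \<Rightarrow> complex mat" where
  "jblocks bs = diag_block_mat (map (\<lambda>(a, k, \<theta>). jordan_block k a) bs)"

definition gblocks :: "block list \<Rightarrow> complex mat" where
  "gblocks bs = diag_block_mat (map (\<lambda>(a, k, \<theta>). \<theta> \<cdot>\<^sub>m sip_mat k) bs)"

definition bsize :: "block list \<Rightarrow> nat" where
  "bsize bs = sum_list (map (\<lambda>(a, k, \<theta>). k) bs)"

lemma bsize_simps [simp]:
  "bsize [] = 0" "bsize ((a, k, \<theta>) # bs) = k + bsize bs" "bsize (bs @ cs) = bsize bs + bsize cs"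
  by (auto simp: bsize_def)

lemma sip_mat_carrier [simp]: "sip_mat k \<in> carrier_mat k k"
  and sip_mat_dim [simp]: "dim_row (sip_mat k) = k" "dim_col (sip_mat k) = k"
  by (auto simp: sip_mat_def)

lemma jblocks_dim [simp]: "dim_row (jblocks bs) = bsize bs" "dim_col (jblocks bs) = bsize bs"
  by (induction bs) (auto simp: jblocks_def Let_def)

lemma gblocks_dim [simp]: "dim_row (gblocks bs) = bsize bs" "dim_col (gblocks bs) = bsize bs"
  by (induction bs) (auto simp: gblocks_def Let_def)

lemma jblocks_carrier [simp]: "jblocks bs \<in> carrier_mat (bsize bs) (bsize bs)"
  and gblocks_carrier [simp]: "gblocks bs \<in> carrier_mat (bsize bs) (bsize bs)"
  by (auto intro: carrier_matI)

lemma jblocks_Cons: "jblocks ((a, k, \<theta>) # bs)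
    = four_block_mat (jordan_block k a) (0\<^sub>m k (bsize bs)) (0\<^sub>m (bsize bs) k) (jblocks bs)"
  using jblocks_dim[of bs] by (simp add: jblocks_def Let_def)

lemma gblocks_Cons: "gblocks ((a, k, \<theta>) # bs)
    = four_block_mat (\<theta> \<cdot>\<^sub>m sip_mat k) (0\<^sub>m k (bsize bs)) (0\<^sub>m (bsize bs) k) (gblocks bs)"
  using gblocks_dim[of bs] by (simp add: gblocks_def Let_def)

lemma jblocks_append: "jblocks (bs @ cs)
    = four_block_mat (jblocks bs) (0\<^sub>m (bsize bs) (bsize cs)) (0\<^sub>m (bsize cs) (bsize bs)) (jblocks cs)"
  unfolding jblocks_def map_append diag_block_mat_append Let_def
  by (simp flip: jblocks_def)

lemma gblocks_append: "gblocks (bs @ cs)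
    = four_block_mat (gblocks bs) (0\<^sub>m (bsize bs) (bsize cs)) (0\<^sub>m (bsize cs) (bsize bs)) (gblocks cs)"
  unfolding gblocks_def map_append diag_block_mat_append Let_def
  by (simp flip: gblocks_def)

lemma sip_mat_square: "sip_mat k * sip_mat k = 1\<^sub>m k"
proof (rule eq_matI)
  fix i j assume "i < dim_row (1\<^sub>m k :: complex mat)" "j < dim_col (1\<^sub>m k :: complex mat)"
  then have ij: "i < k" "j < k" by auto
  have "(sip_mat k * sip_mat k) $$ (i, j)
      = (\<Sum>l\<in>{0..<k}. (if i + l + 1 = k then 1 else 0) * (if l + j + 1 = k then 1 else 0))"
    using ij by (simp add: scalar_prod_def sip_mat_def)
  also have "\<dots> = (\<Sum>l\<in>{0..<k}. if l = k - 1 - i then (if i = j then 1 else 0) else 0)"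
    using ij by (intro sum.cong) auto
  also have "\<dots> = 1\<^sub>m k $$ (i, j)" using ij by (simp add: sum.delta)
  finally show "(sip_mat k * sip_mat k) $$ (i, j) = 1\<^sub>m k $$ (i, j)" .
qed auto

definition signed :: "block list \<Rightarrow> bool" where
  "signed bs \<longleftrightarrow> (\<forall>(a, k, \<theta>) \<in> set bs. 0 < k \<and> (\<theta> = 1 \<or> \<theta> = -1))"

lemma gblocks_square: "signed bs \<Longrightarrow> gblocks bs * gblocks bs = 1\<^sub>m (bsize bs)"
proof (induction bs)
  case Nil
  show ?case by (rule eq_matI) auto
next
  case (Cons b bs)
  obtain a k \<theta> where b: "b = (a, k, \<theta>)" by (cases b)
  have IH: "gblocks bs * gblocks bs = 1\<^sub>m (bsize bs)" using Cons by (auto simp: signed_def)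
  have "\<theta> * \<theta> = 1" using Cons.prems by (auto simp: signed_def b)
  moreover have "(\<theta> \<cdot>\<^sub>m sip_mat k) * (\<theta> \<cdot>\<^sub>m sip_mat k) = \<theta> \<cdot>\<^sub>m (\<theta> \<cdot>\<^sub>m (sip_mat k * sip_mat k))"
    by (simp add: mult_smult_assoc_mat[OF sip_mat_carrier smult_carrier_mat[OF sip_mat_carrier]]
        mult_smult_distrib[OF sip_mat_carrier sip_mat_carrier])
  moreover have "\<theta> \<cdot>\<^sub>m (\<theta> \<cdot>\<^sub>m 1\<^sub>m k) = (\<theta> * \<theta>) \<cdot>\<^sub>m (1\<^sub>m k)"
    by (rule eq_matI) auto
  moreover have "(1::complex) \<cdot>\<^sub>m 1\<^sub>m k = 1\<^sub>m k" by (rule eq_matI) auto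
  ultimately have sq: "(\<theta> \<cdot>\<^sub>m sip_mat k) * (\<theta> \<cdot>\<^sub>m sip_mat k) = 1\<^sub>m k"
    by (simp add: sip_mat_square)
  show ?case unfolding b gblocks_Cons
    by (subst mult_four_block_mat[of _ k k _ "bsize bs" _ "bsize bs" _ _ k _ "bsize bs"])
       (auto simp: IH sq)
qed

lemma gblocks_hermitian: "signed bs \<Longrightarrow> mat_adjoint (gblocks bs) = gblocks bs"
proof (induction bs)
  case Nil
  show ?case by (rule eq_matI) auto
next
  case (Cons b bs)
  obtain a k \<theta> where b: "b = (a, k, \<theta>)" by (cases b)
  have IH: "mat_adjoint (gblocks bs) = gblocks bs" using Cons by (auto simp: signed_def)
  have "cnj \<theta> = \<theta>" using Cons.prems by (auto simp: signed_def b)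
  then have "mat_adjoint (\<theta> \<cdot>\<^sub>m sip_mat k) = \<theta> \<cdot>\<^sub>m sip_mat k"
    by (intro eq_matI) (auto simp: sip_mat_def)
  then show ?case unfolding b gblocks_Cons by (simp add: block_diag_adjoint IH)
qed

lemma bsize_ge_length: "signed bs \<Longrightarrow> length bs \<le> bsize bs"
  by (induction bs) (auto simp: signed_def)

lemma blocks_of_size_one:
  assumes "\<And>b. b \<in> set bs \<Longrightarrow> fst (snd b) = 1"
  shows "bsize bs = length bs"
    and "jblocks bs = mat (length bs) (length bs) (\<lambda>(i, j). if i = j then fst (bs ! i) else 0)"
    and "gblocks bs = mat (length bs) (length bs) (\<lambda>(i, j). if i = j then snd (snd (bs ! i)) else 0)"
proof -
  have "bsize bs = length bs \<and>
    jblocks bs = mat (length bs) (length bs) (\<lambda>(i, j). if i = j then fst (bs ! i) else 0) \<and>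
    gblocks bs = mat (length bs) (length bs) (\<lambda>(i, j). if i = j then snd (snd (bs ! i)) else 0)"
    using assms
  proof (induction bs)
    case Nil
    show ?case by (auto simp: jblocks_def gblocks_def intro!: eq_matI)
  next
    case (Cons b bs)
    obtain a k \<theta> where b: "b = (a, k, \<theta>)" by (cases b)
    have k: "k = 1" using Cons.prems[of b] by (simp add: b)
    have IH: "bsize bs = length bs"
      "jblocks bs = mat (length bs) (length bs) (\<lambda>(i, j). if i = j then fst (bs ! i) else 0)"
      "gblocks bs = mat (length bs) (length bs) (\<lambda>(i, j). if i = j then snd (snd (bs ! i)) else 0)"
      using Cons by auto
    show ?case unfolding b k jblocks_Cons gblocks_Cons IH(2,3)
      by (auto simp: IH(1) nth_Cons' sip_mat_def intro!: eq_matI)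
  qed
  then show "bsize bs = length bs"
    "jblocks bs = mat (length bs) (length bs) (\<lambda>(i, j). if i = j then fst (bs ! i) else 0)"
    "gblocks bs = mat (length bs) (length bs) (\<lambda>(i, j). if i = j then snd (snd (bs ! i)) else 0)"
    by auto
qed

text \<open>With \<open>N\<close> and \<open>G\<close> for the two matrices, the identity \<open>NG + GN = 1\<close> shows that every \<open>y\<close> in the
  kernel of \<open>N\<close> is \<open>N (G y)\<close>, that is, the kernel of \<open>N\<close> equals its range.  This is how
  the isotropy of the kernel is derived below.\<close>

lemma blocks_of_size_two:
  defines "b t \<equiv> replicate t (0, 2, 1)"
  shows "jblocks (b t) * jblocks (b t) = 0\<^sub>m (2 * t) (2 * t)" (is "?nil t")
    and "jblocks (b t) * gblocks (b t) + gblocks (b t) * jblocks (b t) = 1\<^sub>m (2 * t)" (is "?anti t")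
    and "gblocks (b t) * jblocks (b t) = mat_adjoint (jblocks (b t)) * gblocks (b t)" (is "?self t")
    and "bsize (b t) = 2 * t" (is "?size t")
proof -
  let ?J = "jordan_block 2 (0::complex)" and ?Q = "1 \<cdot>\<^sub>m sip_mat 2"
  have two: "i < 2 \<Longrightarrow> i = 0 \<or> i = 1" for i :: nat by auto
  have sc: "{0..<2} = {0, 1 :: nat}" by auto
  have base: "?J * ?J = 0\<^sub>m 2 2" "?J * ?Q + ?Q * ?J = 1\<^sub>m 2" "?Q * ?J = mat_adjoint ?J * ?Q"
    by (rule eq_matI; auto dest!: two simp: sip_mat_def scalar_prod_def sc)+
  have Qc: "?Q \<in> carrier_mat 2 2" by simp
  have "?nil t \<and> ?anti t \<and> ?self t \<and> ?size t"
  proof (induction t)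
    case 0
    show ?case by (auto simp: b_def jblocks_def gblocks_def intro!: eq_matI)
  next
    case (Suc t)
    then have IH: "?nil t" "?anti t" "?self t" "?size t" by auto
    let ?N = "jblocks (b t)" and ?G = "gblocks (b t)" and ?m = "2 * t"
    have c: "?N \<in> carrier_mat ?m ?m" "?G \<in> carrier_mat ?m ?m" using IH(4) by (metis jblocks_carrier gblocks_carrier)+
    have bS: "b (Suc t) = (0, 2, 1) # b t" by (simp add: b_def)
    have N: "jblocks (b (Suc t)) = four_block_mat ?J (0\<^sub>m 2 ?m) (0\<^sub>m ?m 2) ?N"
      and G: "gblocks (b (Suc t)) = four_block_mat ?Q (0\<^sub>m 2 ?m) (0\<^sub>m ?m 2) ?G"
      unfolding bS jblocks_Cons gblocks_Cons IH(4) by simp_all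
    note mult = block_diag_mult[of _ 2 _ _ ?m]
    have "?nil (Suc t)" unfolding N using c by (simp add: mult IH(1) base)
    moreover have "?anti (Suc t)" unfolding N G using c Qc
      by (simp only: mult jordan_block_carrier)
        (subst add_four_block_mat[of _ 2 2 _ ?m _ ?m], auto simp: IH(2) base(2))
    moreover have adj: "mat_adjoint (jblocks (b (Suc t))) = four_block_mat (mat_adjoint ?J) (0\<^sub>m 2 ?m) (0\<^sub>m ?m 2) (mat_adjoint ?N)"
      unfolding N using c by (subst adjoint_four_block[of _ 2 2 _ ?m _ ?m]) auto
    have "?self (Suc t)" unfolding adj unfolding N G using c Qc
      by (subst mult, simp_all)+ (simp add: IH(3) base)
    moreover have "?size (Suc t)" using IH(4) unfolding bS by simp
    ultimately show ?case by blast
  qed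
  then show "?nil t" "?anti t" "?self t" "?size t" by blast+
qed

section \<open>Partial canonical bases of a selfadjoint pair\<close>

text \<open>The canonical basis of a pair is built up by adding one Jordan chain after the other.  At each stage
  the next chain is taken from the orthogonal complement of the chains found so far, which is
  invariant under \<open>A\<close> and on which the form is nondegenerate.\<close>

locale selfadjoint_pair =
  fixes n :: nat and H A :: "complex mat"
  assumes H [simp]: "H \<in> carrier_mat n n" and A [simp]: "A \<in> carrier_mat n n"
    and H_herm: "mat_adjoint H = H"
    and H_inv: "\<exists>K \<in> carrier_mat n n. K * H = 1\<^sub>m n"
    and self: "H * A = mat_adjoint A * H"
begin

abbreviation ip :: "complex vec \<Rightarrow> complex vec \<Rightarrow> complex" where
  "ip \<equiv> indef_prod H"

lemma A_dim [simp]: "dim_row A = n" "dim_col A = n" "dim_row H = n" "dim_col H = n"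
  using A H by (auto simp del: A H)

lemma A_vec [simp]: "x \<in> carrier_vec n \<Longrightarrow> A *\<^sub>v x \<in> carrier_vec n"
  and H_vec [simp]: "y \<in> carrier_vec n \<Longrightarrow> H *\<^sub>v y \<in> carrier_vec n"
  by (auto intro: mult_mat_vec_carrier[OF A] mult_mat_vec_carrier[OF H])

lemma H_cancel: "x \<in> carrier_vec n \<Longrightarrow> H *\<^sub>v x = 0\<^sub>v n \<Longrightarrow> x = 0\<^sub>v n"
  using H_inv by (metis H assoc_mult_mat_vec one_mult_mat_vec mult_mat_vec_null)

lemma ip_add_left: "x \<in> carrier_vec n \<Longrightarrow> y \<in> carrier_vec n \<Longrightarrow> z \<in> carrier_vec n \<Longrightarrow>
    ip (x + y) z = ip x z + ip y z"
  unfolding indef_prod_def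
  by (simp add: mult_add_distrib_mat_vec[OF H] add_scalar_prod_distrib[of _ n])

lemma ip_add_right: "x \<in> carrier_vec n \<Longrightarrow> y \<in> carrier_vec n \<Longrightarrow> z \<in> carrier_vec n \<Longrightarrow>
    ip z (x + y) = ip z x + ip z y"
  unfolding indef_prod_def
  by (simp add: conjugate_add_vec[of _ n] scalar_prod_add_distrib[of _ n])

lemma ip_smult_left: "x \<in> carrier_vec n \<Longrightarrow> y \<in> carrier_vec n \<Longrightarrow> ip (c \<cdot>\<^sub>v x) y = c * ip x y"
  unfolding indef_prod_def by (simp add: mult_mat_vec[OF H])

lemma ip_smult_right: "x \<in> carrier_vec n \<Longrightarrow> y \<in> carrier_vec n \<Longrightarrow> ip x (c \<cdot>\<^sub>v y) = cnj c * ip x y"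
  unfolding indef_prod_def by (simp add: conjugate_smult_vec)

lemma ip_commute: "x \<in> carrier_vec n \<Longrightarrow> y \<in> carrier_vec n \<Longrightarrow> ip y x = cnj (ip x y)"
proof -
  assume x: "x \<in> carrier_vec n" and y: "y \<in> carrier_vec n"
  have "ip y x = y \<bullet>c (H *\<^sub>v x)"
    unfolding indef_prod_def using adjoint_vec[OF H y x] by (simp add: H_herm)
  also have "\<dots> = cnj ((H *\<^sub>v x) \<bullet>c y)"
    using x y conjugate_conjugate_sprod[of y n "H *\<^sub>v x"] conjugate_vec_sprod_comm[of y n "H *\<^sub>v x"]
    by (metis H_vec conjugate_complex_def conjugate_conjugate_sprod conjugate_vec_sprod_comm)
  finally show ?thesis by (simp add: indef_prod_def)
qed

lemma ip_self: "x \<in> carrier_vec n \<Longrightarrow> y \<in> carrier_vec n \<Longrightarrow> ip (A *\<^sub>v x) y = ip x (A *\<^sub>v y)"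
proof -
  assume x: "x \<in> carrier_vec n" and y: "y \<in> carrier_vec n"
  have "ip (A *\<^sub>v x) y = (H * A *\<^sub>v x) \<bullet>c y"
    using x by (simp add: indef_prod_def assoc_mult_mat_vec[OF H A])
  also have "\<dots> = (mat_adjoint A *\<^sub>v (H *\<^sub>v x)) \<bullet>c y"
    using x by (simp add: self assoc_mult_mat_vec[of _ n n _ n])
  also have "\<dots> = ip x (A *\<^sub>v y)"
    unfolding indef_prod_def using x y by (simp add: adjoint_vec[of _ n n])
  finally show ?thesis .
qed

lemma ip_zero [simp]: "x \<in> carrier_vec n \<Longrightarrow> ip (0\<^sub>v n) x = 0" "x \<in> carrier_vec n \<Longrightarrow> ip x (0\<^sub>v n) = 0"
  by (auto simp: indef_prod_def mult_mat_vec_null[OF H])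

text \<open>The entries of a Gram matrix appear with the two indices exchanged, because the inner product is
  linear in its first argument.\<close>

lemma gram_index:
  assumes "X \<in> carrier_mat n k" "Y \<in> carrier_mat n l" "i < k" "j < l"
  shows "(mat_adjoint X * H * Y) $$ (i, j) = ip (col Y j) (col X i)"
proof -
  have "(mat_adjoint X * H * Y) $$ (i, j) = (mat_adjoint X * (H * Y)) $$ (i, j)"
    using assms by (simp add: assoc_mult_mat[of _ k n _ n])
  also have "\<dots> = row (mat_adjoint X) i \<bullet> (H *\<^sub>v col Y j)"
    using assms by (simp add: col_mult2[of _ n n])
  also have "row (mat_adjoint X) i = conjugate (col X i)"
    using assms by (intro eq_vecI) auto
  also have "\<dots> \<bullet> (H *\<^sub>v col Y j) = (H *\<^sub>v col Y j) \<bullet>c col X i"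
    using assms by (intro comm_scalar_prod[of _ n]) auto
  finally show ?thesis by (simp add: indef_prod_def)
qed

lemma ip_col:
  assumes S: "S \<in> carrier_mat n k" and w: "w \<in> carrier_vec n" and j: "j < k"
  shows "ip w (col S j) = (mat_adjoint S * H *\<^sub>v w) $ j"
proof -
  have "ip w (col S j) = (mat_adjoint S * H * mat_of_cols n [w]) $$ (j, 0)"
    using S w j by (subst gram_index[of _ k _ 1]) (auto simp: mat_of_cols_def intro!: eq_vecI arg_cong2[where f = ip])
  also have "\<dots> = (mat_adjoint S * H *\<^sub>v w) $ j"
    using S w j by (auto simp: mat_of_cols_def intro!: arg_cong2[where f = "(\<bullet>)"] eq_vecI)
  finally show ?thesis .
qed

lemma ip_null:
  assumes x: "x \<in> carrier_vec n" and null: "\<And>y. y \<in> carrier_vec n \<Longrightarrow> ip x y = 0"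
  shows "x = 0\<^sub>v n"
proof -
  have "(H *\<^sub>v x) \<bullet>c (H *\<^sub>v x) = 0" using null[of "H *\<^sub>v x"] x by (simp add: indef_prod_def)
  then have "H *\<^sub>v x = 0\<^sub>v n" using x conjugate_square_eq_0_vec[of "H *\<^sub>v x" n] by simp
  then show ?thesis using H_cancel x by blast
qed

definition orth :: "complex mat \<Rightarrow> complex vec set" where
  "orth S = {w \<in> carrier_vec n. \<forall>j < dim_col S. ip w (col S j) = 0}"

lemma orth_carrier: "w \<in> orth S \<Longrightarrow> w \<in> carrier_vec n"
  by (simp add: orth_def)

lemma orth_add [intro]:
  "S \<in> carrier_mat n k \<Longrightarrow> v \<in> orth S \<Longrightarrow> w \<in> orth S \<Longrightarrow> v + w \<in> orth S"
  by (auto simp: orth_def ip_add_left)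

lemma orth_smult [intro]: "S \<in> carrier_mat n k \<Longrightarrow> w \<in> orth S \<Longrightarrow> c \<cdot>\<^sub>v w \<in> orth S"
  by (auto simp: orth_def ip_smult_left intro!: ip_smult_left[THEN trans])

text \<open>The columns of \<open>S\<close> form part of a canonical basis: they span an \<open>A\<close>-invariant nondegenerate subspace,
  on which \<open>A\<close> and the form are given by the blocks \<open>bs\<close>.  The matrix \<open>S\<close> need not be square.\<close>

definition canon :: "block list \<Rightarrow> complex mat \<Rightarrow> bool" where
  "canon bs S \<longleftrightarrow> S \<in> carrier_mat n (bsize bs) \<and> A * S = S * jblocks bs \<and>
     mat_adjoint S * H * S = gblocks bs"

lemma canon_carrier [simp]: "canon bs S \<Longrightarrow> S \<in> carrier_mat n (bsize bs)"
  by (simp add: canon_def)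

lemma ip_mult_mat:
  assumes S: "S \<in> carrier_mat n k" and w: "w \<in> carrier_vec n" and v: "v \<in> carrier_vec k"
  shows "ip w (S *\<^sub>v v) = (\<Sum>j<k. cnj (v $ j) * ip w (col S j))"
proof -
  have "conjugate (S *\<^sub>v v) $ i = (\<Sum>j<k. cnj (v $ j) * conjugate (col S j) $ i)" if "i < n" for i
    using that S v by (simp add: scalar_prod_def atLeast0LessThan mult.commute)
  then have "ip w (S *\<^sub>v v) = (\<Sum>i<n. \<Sum>j<k. (H *\<^sub>v w) $ i * (cnj (v $ j) * conjugate (col S j) $ i))"
    unfolding indef_prod_def scalar_prod_def using S
    by (simp add: atLeast0LessThan sum_distrib_left del: index_mult_mat_vec vec_index_conjugate)
  also have "\<dots> = (\<Sum>j<k. cnj (v $ j) * (\<Sum>i<n. (H *\<^sub>v w) $ i * conjugate (col S j) $ i))"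
    by (subst sum.swap) (simp add: sum_distrib_left mult_ac)
  also have "\<dots> = (\<Sum>j<k. cnj (v $ j) * ip w (col S j))"
    unfolding indef_prod_def scalar_prod_def using S by (simp add: atLeast0LessThan)
  finally show ?thesis .
qed

lemma orth_range:
  "S \<in> carrier_mat n k \<Longrightarrow> w \<in> orth S \<Longrightarrow> v \<in> carrier_vec k \<Longrightarrow> ip w (S *\<^sub>v v) = 0"
  by (subst ip_mult_mat) (auto simp: orth_def)

lemma orth_A:
  assumes can: "canon bs S" and w: "w \<in> orth S"
  shows "A *\<^sub>v w \<in> orth S"
proof -
  have S: "S \<in> carrier_mat n (bsize bs)" and AS: "A * S = S * jblocks bs"
    using can by (auto simp: canon_def)
  have "ip (A *\<^sub>v w) (col S j) = 0" if j: "j < bsize bs" for j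
  proof -
    have "A *\<^sub>v col S j = col (A * S) j" using S j by (simp add: col_mult2[of _ n n])
    also have "\<dots> = S *\<^sub>v col (jblocks bs) j"
      unfolding AS using S j by (simp add: col_mult2[of _ n "bsize bs" _ "bsize bs"])
    finally have "ip (A *\<^sub>v w) (col S j) = ip w (S *\<^sub>v col (jblocks bs) j)"
      using orth_carrier[OF w] S j by (simp add: ip_self)
    also have "\<dots> = 0" by (rule orth_range[OF S w]) (metis col_dim jblocks_dim(1))
    finally show ?thesis .
  qed
  then show ?thesis using orth_carrier[OF w] S by (auto simp: orth_def)
qed

lemma canon_Nil: "canon [] (0\<^sub>m n 0)"
  by (auto simp: canon_def jblocks_def gblocks_def intro!: eq_matI)

text \<open>New columns are put in front of the old ones.  So the order in which the kinds of chains are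
  exhausted is the reverse of their order in the final canonical form.\<close>

lemma canon_extend:
  assumes can: "canon bs S" and X: "X \<in> carrier_mat n k"
    and AX: "A * X = X * jordan_block k a"
    and HX: "mat_adjoint X * H * X = \<theta> \<cdot>\<^sub>m sip_mat k"
    and XS: "\<And>j. j < k \<Longrightarrow> col X j \<in> orth S"
  obtains S' where "canon ((a, k, \<theta>) # bs) S'" "orth S' \<subseteq> orth S"
proof
  let ?m = "bsize bs"
  have S: "S \<in> carrier_mat n ?m" and AS: "A * S = S * jblocks bs"
    and HS: "mat_adjoint S * H * S = gblocks bs" using can by (auto simp: canon_def)
  \<comment> \<open>The two blocks of height \<open>0\<close> turn \<open>[X S]\<close> into a block matrix, so that block multiplication
    applies.\<close>
  define S' where "S' = four_block_mat X S (0\<^sub>m 0 k) (0\<^sub>m 0 ?m)"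
  have dims: "dim_row S' = n" "dim_col S' = k + ?m" using X S by (auto simp: S'_def)
  have S': "S' \<in> carrier_mat n (k + ?m)" using dims by (auto intro: carrier_matI)
  have colX: "col S' j = col X j" if "j < k" for j
    using that X S by (intro eq_vecI) (auto simp: S'_def)
  have colS: "col S' (k + j) = col S j" if "j < ?m" for j
    using that X S by (intro eq_vecI) (auto simp: S'_def)
  have S'Y: "A * S' = four_block_mat (A * X) (A * S) (0\<^sub>m 0 k) (0\<^sub>m 0 ?m)" (is "_ = ?R")
  proof (rule eq_matI)
    fix i j assume "i < dim_row ?R" "j < dim_col ?R"
    then have i: "i < n" and j: "j < k + ?m" using X S by auto
    show "(A * S') $$ (i, j) = ?R $$ (i, j)"
    proof (cases "j < k")
      case True
      then show ?thesis using i j X S by (simp add: dims colX)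
    next
      case False
      then obtain l where l: "j = k + l" by (metis add_diff_inverse_nat)
      then show ?thesis using i j X S by (simp add: dims colS)
    qed
  qed (use X S dims in auto)
  have "S' * jblocks ((a, k, \<theta>) # bs) = ?R"
    unfolding S'_def jblocks_Cons
    apply (subst mult_four_block_mat[of _ n k _ ?m _ 0 _ _ k _ ?m])
    using X S by (auto simp: AX AS intro!: cong_four_block_mat)
  moreover have "mat_adjoint S' * H * S' = gblocks ((a, k, \<theta>) # bs)"
  proof (rule eq_matI)
    fix i j assume "i < dim_row (gblocks ((a, k, \<theta>) # bs))" "j < dim_col (gblocks ((a, k, \<theta>) # bs))"
    then have i: "i < k + ?m" and j: "j < k + ?m" by auto
    have eq: "(mat_adjoint S' * H * S') $$ (i, j) = ip (col S' j) (col S' i)"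
      by (rule gram_index[OF S' S' i j])
    have XS0: "ip (col X i) (col S j) = 0" "ip (col S j) (col X i) = 0" if "i < k" "j < ?m" for i j
    proof -
      show 0: "ip (col X i) (col S j) = 0" using XS[OF that(1)] that S by (auto simp: orth_def)
      show "ip (col S j) (col X i) = 0"
        using ip_commute[of "col X i" "col S j"] 0 carrier_matD(1)[OF X] carrier_matD(1)[OF S]
        by (metis carrier_vecI col_def complex_cnj_zero dim_vec)
    qed
    show "(mat_adjoint S' * H * S') $$ (i, j) = gblocks ((a, k, \<theta>) # bs) $$ (i, j)"
    proof (cases "i < k")
      case True
      show ?thesis
      proof (cases "j < k")
        case j: True
        have "ip (col S' j) (col S' i) = (mat_adjoint X * H * X) $$ (i, j)"
          using True j by (simp add: colX gram_index[OF X X])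
        then show ?thesis unfolding eq HX using True j i by (simp add: gblocks_Cons)
      next
        case False
        then obtain l where l: "j = k + l" by (metis add_diff_inverse_nat)
        then show ?thesis unfolding eq using True i j by (simp add: colX colS gblocks_Cons XS0)
      qed
    next
      case False
      then obtain m where m: "i = k + m" by (metis add_diff_inverse_nat)
      show ?thesis
      proof (cases "j < k")
        case j: True
        show ?thesis unfolding eq using i m j by (simp add: colX colS gblocks_Cons XS0)
      next
        case False
        then obtain l where l: "j = k + l" by (metis add_diff_inverse_nat)
        have "ip (col S' j) (col S' i) = (mat_adjoint S * H * S) $$ (m, l)"
          using i j l m by (simp add: colS gram_index[OF S S])
        then show ?thesis unfolding eq HS using i j m l by (simp add: gblocks_Cons)
      qed
    qed
  qed (use dims in auto)
  ultimately show "canon ((a, k, \<theta>) # bs) S'"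
    using S' S'Y by (simp add: canon_def)
  show "orth S' \<subseteq> orth S"
  proof
    fix w assume "w \<in> orth S'"
    then have w: "w \<in> carrier_vec n" "\<And>j. j < k + ?m \<Longrightarrow> ip w (col S' j) = 0"
      by (auto simp: orth_def dims)
    have "ip w (col S j) = 0" if "j < ?m" for j
      using w(2)[of "k + j"] that by (simp add: colS)
    then show "w \<in> orth S" using w(1) S by (auto simp: orth_def)
  qed
qed

lemma canon_gram_square:
  assumes can: "canon bs S" and sg: "signed bs"
  shows "gblocks bs * (mat_adjoint S * H * S) = 1\<^sub>m (bsize bs)"
  using can gblocks_square[OF sg] by (simp add: canon_def)

text \<open>The Gram matrix of the columns of \<open>S\<close> is invertible, hence they are independent.\<close>

lemma canon_bound:
  assumes can: "canon bs S" and sg: "signed bs"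
  shows "bsize bs \<le> n"
proof (rule ccontr)
  assume "\<not> bsize bs \<le> n"
  then have "n < bsize bs" by simp
  moreover have S: "S \<in> carrier_mat n (bsize bs)" using can by simp
  ultimately obtain v where v: "v \<in> carrier_vec (bsize bs)" "v \<noteq> 0\<^sub>v (bsize bs)" "S *\<^sub>v v = 0\<^sub>v n"
    using underdetermined_mat by blast
  have "v = gblocks bs * (mat_adjoint S * H * S) *\<^sub>v v"
    using v by (simp add: canon_gram_square[OF assms])
  also have "\<dots> = (gblocks bs * (mat_adjoint S * H)) *\<^sub>v (S *\<^sub>v v)"
  proof -
    have MH: "mat_adjoint S * H \<in> carrier_mat (bsize bs) n"
      using S by (intro mult_carrier_mat[of _ _ n]) auto
    have "gblocks bs * (mat_adjoint S * H * S) = gblocks bs * (mat_adjoint S * H) * S"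
      by (rule assoc_mult_mat[OF gblocks_carrier MH S, symmetric])
    moreover have "gblocks bs * (mat_adjoint S * H) \<in> carrier_mat (bsize bs) n"
      by (rule mult_carrier_mat[OF gblocks_carrier MH])
    ultimately show ?thesis using assoc_mult_mat_vec[OF _ S v(1)] by simp
  qed
  also have "\<dots> = 0\<^sub>v (bsize bs)"
    unfolding v(3) using S by (intro mult_mat_vec_null) auto
  finally show False using v(2) by simp
qed

text \<open>If nothing is orthogonal to the columns of \<open>S\<close>, then there are \<open>n\<close> of them.  As the signs are \<open>\<plusminus>1\<close>,
  the Gram matrix is its own inverse, which gives the inverse of \<open>S\<close> explicitly.\<close>

lemma canon_complete:
  assumes can: "canon bs S" and sg: "signed bs" and triv: "orth S \<subseteq> {0\<^sub>v n}"
  obtains Sinv where "bsize bs = n" "S \<in> carrier_mat n n" "Sinv \<in> carrier_mat n n"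
    "S * Sinv = 1\<^sub>m n" "Sinv * S = 1\<^sub>m n" "Sinv * A * S = jblocks bs"
proof -
  have S: "S \<in> carrier_mat n (bsize bs)" using can by simp
  have "\<not> bsize bs < n"
  proof
    assume less: "bsize bs < n"
    have "mat_adjoint S * H \<in> carrier_mat (bsize bs) n" using S by auto
    from underdetermined_mat[OF this less] obtain v
      where v: "v \<in> carrier_vec n" "v \<noteq> 0\<^sub>v n" "mat_adjoint S * H *\<^sub>v v = 0\<^sub>v (bsize bs)" by auto
    have "ip v (col S j) = 0" if "j < bsize bs" for j
      using ip_col[OF S v(1) that] v(3) that by simp
    then have "v \<in> orth S" using v(1) S by (auto simp: orth_def)
    with triv v(2) show False by auto
  qed
  with canon_bound[OF can sg] have k: "bsize bs = n" by simp
  define Sinv where "Sinv = gblocks bs * (mat_adjoint S * H)"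
  have S: "S \<in> carrier_mat n n" using S k by simp
  have G: "gblocks bs \<in> carrier_mat n n" using gblocks_carrier[of bs] k by simp
  have Sinv: "Sinv \<in> carrier_mat n n"
    unfolding Sinv_def using S G by (intro mult_carrier_mat[of _ n n]) auto
  have l: "Sinv * S = 1\<^sub>m n"
  proof -
    have "Sinv * S = gblocks bs * (mat_adjoint S * H * S)"
      unfolding Sinv_def using S G by (subst assoc_mult_mat[of _ n n _ n _ n]) auto
    then show ?thesis using canon_gram_square[OF can sg] k by simp
  qed
  have r: "S * Sinv = 1\<^sub>m n" by (rule mat_mult_left_right_inverse[OF Sinv S l])
  have "Sinv * A * S = Sinv * (A * S)" using Sinv S by (simp add: assoc_mult_mat[of _ n n _ n _ n])
  also have "\<dots> = Sinv * (S * jblocks bs)" using can by (simp add: canon_def)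
  also have "\<dots> = (Sinv * S) * jblocks bs"
    using Sinv S jblocks_carrier[of bs] k by (simp add: assoc_mult_mat[of _ n n _ n _ n])
  also have "\<dots> = jblocks bs" using jblocks_carrier[of bs] k by (simp add: l)
  finally show thesis using that k S Sinv l r by blast
qed

text \<open>Orthogonal projection along the columns of \<open>S\<close>; it exists because their Gram matrix is invertible.\<close>

lemma orth_split:
  assumes can: "canon bs S" and sg: "signed bs" and v: "v \<in> carrier_vec n"
  obtains c where "c \<in> carrier_vec (bsize bs)" "v + S *\<^sub>v c \<in> orth S"
proof -
  have S: "S \<in> carrier_mat n (bsize bs)" using can by simp
  let ?m = "bsize bs"
  let ?G = "gblocks bs" and ?S = "mat_adjoint S * H"
  define c where "c = - (?G *\<^sub>v (?S *\<^sub>v v))"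
  have c: "c \<in> carrier_vec ?m" unfolding c_def using S v by (auto intro!: mult_mat_vec_carrier)
  have Sv: "?S *\<^sub>v v \<in> carrier_vec ?m" using S v by (auto intro!: mult_mat_vec_carrier)
  have "?S *\<^sub>v (S *\<^sub>v c) = (?S * S) *\<^sub>v c"
    using S c by (intro assoc_mult_mat_vec[symmetric, of _ ?m n _ ?m]) auto
  also have "\<dots> = ?G *\<^sub>v c" using can by (simp add: canon_def)
  also have "\<dots> = - (?G *\<^sub>v (?G *\<^sub>v (?S *\<^sub>v v)))"
    unfolding c_def using Sv
    by (intro mult_mat_vec_neg[of _ ?m ?m]) (auto intro!: mult_mat_vec_carrier[OF gblocks_carrier])
  also have "?G *\<^sub>v (?G *\<^sub>v (?S *\<^sub>v v)) = ?S *\<^sub>v v"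
    using Sv gblocks_square[OF sg]
    by (subst assoc_mult_mat_vec[symmetric, of _ ?m ?m _ ?m]) auto
  finally have eq: "?S *\<^sub>v (S *\<^sub>v c) = - (?S *\<^sub>v v)" .
  have Sc: "S *\<^sub>v c \<in> carrier_vec n" using S c by (auto intro!: mult_mat_vec_carrier)
  have "?S *\<^sub>v (v + S *\<^sub>v c) = ?S *\<^sub>v v + ?S *\<^sub>v (S *\<^sub>v c)"
    using S v Sc by (intro mult_add_distrib_mat_vec[of _ ?m n]) auto
  also have "\<dots> = 0\<^sub>v ?m" unfolding eq using Sv by auto
  finally have "?S *\<^sub>v (v + S *\<^sub>v c) = 0\<^sub>v ?m" .
  moreover have vc: "v + S *\<^sub>v c \<in> carrier_vec n" using v Sc by simp
  ultimately have "ip (v + S *\<^sub>v c) (col S j) = 0" if "j < ?m" for j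
    using ip_col[OF S vc that] that by simp
  then have "v + S *\<^sub>v c \<in> orth S" using vc S by (auto simp: orth_def)
  with c show thesis using that by blast
qed

text \<open>Every vector of the space differs from one in \<open>orth S\<close> by a combination of the columns of \<open>S\<close>, so
  what is orthogonal to all of \<open>orth S\<close> is orthogonal to everything.\<close>

lemma orth_nondegenerate:
  assumes can: "canon bs S" and sg: "signed bs" and x: "x \<in> orth S"
    and null: "\<And>y. y \<in> orth S \<Longrightarrow> ip x y = 0"
  shows "x = 0\<^sub>v n"
proof -
  have xc: "x \<in> carrier_vec n" by (rule orth_carrier[OF x])
  have all: "ip x v = 0" if v: "v \<in> carrier_vec n" for v
  proof -
    obtain c where c: "c \<in> carrier_vec (bsize bs)" "v + S *\<^sub>v c \<in> orth S"
      using orth_split[OF can sg v] by blast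
    have S: "S \<in> carrier_mat n (bsize bs)" using can by simp
    have "0 = ip x (v + S *\<^sub>v c)" using null[OF c(2)] by simp
    also have "\<dots> = ip x v + ip x (S *\<^sub>v c)"
      using v xc S c by (intro ip_add_right) (auto intro!: mult_mat_vec_carrier)
    also have "ip x (S *\<^sub>v c) = 0" by (rule orth_range[OF S x c(1)])
    finally show ?thesis by simp
  qed
  show ?thesis by (rule ip_null[OF xc all])
qed

text \<open>The vectors \<open>xs\<close> are a Jordan chain in the complement of the columns of \<open>S\<close>, listed from the
  eigenvector upwards, and their Gram matrix is \<open>\<theta>\<close> times the anti-diagonal unit matrix.\<close>

definition chain :: "complex mat \<Rightarrow> block \<Rightarrow> complex vec list \<Rightarrow> bool" where
  "chain S = (\<lambda>(a, k, \<theta>) xs. length xs = k \<and> set xs \<subseteq> orth S \<and>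
     (\<forall>j<k. A *\<^sub>v (xs ! j) = a \<cdot>\<^sub>v (xs ! j) + (if j = 0 then 0\<^sub>v n else xs ! (j - 1))) \<and>
     (\<forall>i<k. \<forall>j<k. ip (xs ! j) (xs ! i) = (if i + j + 1 = k then \<theta> else 0)))"

lemma canon_extend_chain:
  assumes can: "canon bs S" and ch: "chain S (a, k, \<theta>) xs"
  obtains S' where "canon ((a, k, \<theta>) # bs) S'" "orth S' \<subseteq> orth S"
proof -
  have len: "length xs = k" and xs: "\<And>j. j < k \<Longrightarrow> xs ! j \<in> orth S"
    and Ax: "\<And>j. j < k \<Longrightarrow> A *\<^sub>v (xs ! j) = a \<cdot>\<^sub>v (xs ! j) + (if j = 0 then 0\<^sub>v n else xs ! (j - 1))"
    and Hx: "\<And>i j. i < k \<Longrightarrow> j < k \<Longrightarrow> ip (xs ! j) (xs ! i) = (if i + j + 1 = k then \<theta> else 0)"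
    using ch nth_mem[of _ xs] by (auto simp: chain_def)
  define X where "X = mat_of_cols n xs"
  have X: "X \<in> carrier_mat n k" using len mat_of_cols_carrier(1)[of n xs] by (simp add: X_def)
  have col: "col X j = xs ! j" if "j < k" for j
    unfolding X_def using that len orth_carrier[OF xs[OF that]] by simp
  have "A * X = X * jordan_block k a"
  proof (rule eq_matI)
    fix i j assume "i < dim_row (X * jordan_block k a)" "j < dim_col (X * jordan_block k a)"
    then have i: "i < n" and j: "j < k" using X by auto
    have "(A * X) $$ (i, j) = (A *\<^sub>v (xs ! j)) $ i" using i j X by (simp add: col)
    also have "\<dots> = a * (xs ! j $ i) + (if j = 0 then 0 else xs ! (j - 1) $ i)"
    proof (cases "j = 0")
      case False
      then have "xs ! (j - 1) \<in> carrier_vec n" using j by (intro orth_carrier[OF xs]) simp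
      then show ?thesis unfolding Ax[OF j] using i orth_carrier[OF xs[OF j]] False by simp
    next
      case True
      then show ?thesis unfolding Ax[OF j] using i orth_carrier[OF xs[OF j]] by simp
    qed
    also have "\<dots> = (\<Sum>l\<in>{0..<k}. xs ! l $ i * (if l = j then a else if Suc l = j then 1 else 0))"
    proof -
      have "(\<Sum>l\<in>{0..<k}. xs ! l $ i * (if l = j then a else if Suc l = j then 1 else 0))
        = (\<Sum>l\<in>{0..<k}. (if l = j then a * (xs ! j $ i) else 0) + (if l = j - 1 then (if j = 0 then 0 else xs ! (j - 1) $ i) else 0))"
        by (rule sum.cong) auto
      also have "\<dots> = a * (xs ! j $ i) + (if j = 0 then 0 else xs ! (j - 1) $ i)"
        using j by (simp add: sum.distrib sum.delta)
      finally show ?thesis by simp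
    qed
    also have "\<dots> = (\<Sum>l\<in>{0..<k}. X $$ (i, l) * jordan_block k a $$ (l, j))"
    proof (rule sum.cong[OF refl])
      fix l assume l: "l \<in> {0..<k}"
      have "X $$ (i, l) = xs ! l $ i" using l i len by (simp add: X_def mat_of_cols_index)
      then show "xs ! l $ i * (if l = j then a else if Suc l = j then 1 else 0) = X $$ (i, l) * jordan_block k a $$ (l, j)"
        using l j by simp
    qed
    also have "\<dots> = (X * jordan_block k a) $$ (i, j)"
      using i j X by (simp add: scalar_prod_def)
    finally show "(A * X) $$ (i, j) = (X * jordan_block k a) $$ (i, j)" .
  qed (use X in auto)
  moreover have "mat_adjoint X * H * X = \<theta> \<cdot>\<^sub>m sip_mat k"
  proof (rule eq_matI)
    fix i j assume "i < dim_row (\<theta> \<cdot>\<^sub>m sip_mat k)" "j < dim_col (\<theta> \<cdot>\<^sub>m sip_mat k)"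
    then have ij: "i < k" "j < k" by auto
    show "(mat_adjoint X * H * X) $$ (i, j) = (\<theta> \<cdot>\<^sub>m sip_mat k) $$ (i, j)"
      unfolding gram_index[OF X X ij] using ij by (simp add: col Hx sip_mat_def)
  qed (use X in auto)
  moreover have "col X j \<in> orth S" if "j < k" for j using col[OF that] xs[OF that] by simp
  ultimately show thesis using canon_extend[OF can X] that by blast
qed

text \<open>By the bound on the number of columns, chains of a given kind can be added only finitely often.
  The inclusion of the complements guarantees that kinds exhausted earlier remain exhausted.\<close>

lemma canon_maximal:
  assumes can: "canon bs S" and sg: "signed bs" and T: "signed T"
  obtains cs S' where "set cs \<subseteq> set T" "canon (cs @ bs) S'" "orth S' \<subseteq> orth S"
    "\<And>b xs. b \<in> set T \<Longrightarrow> \<not> chain S' b xs"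
proof -
  define P where "P = (\<lambda>l. \<exists>cs S'. length cs = l \<and> set cs \<subseteq> set T \<and> canon (cs @ bs) S' \<and> orth S' \<subseteq> orth S)"
  have sgcs: "signed (cs @ bs)" if "set cs \<subseteq> set T" for cs
    using that sg T by (auto simp: signed_def)
  have "P 0" unfolding P_def using can by (intro exI[of _ "[]"] exI[of _ S]) auto
  moreover have "l \<le> n" if Pl: "P l" for l
  proof -
    from Pl obtain cs S' where *: "length cs = l" "set cs \<subseteq> set T" "canon (cs @ bs) S'"
      unfolding P_def by blast
    have "l \<le> length (cs @ bs)" using *(1) by simp
    also have "\<dots> \<le> bsize (cs @ bs)" by (rule bsize_ge_length[OF sgcs[OF *(2)]])
    also have "\<dots> \<le> n" by (rule canon_bound[OF *(3) sgcs[OF *(2)]])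
    finally show ?thesis .
  qed
  ultimately obtain l where l: "P l" and max: "\<And>m. P m \<Longrightarrow> m \<le> l"
    using GreatestI_nat[of P 0 n] Greatest_le_nat[of P _ n] by blast
  from l obtain cs S' where cs: "length cs = l" "set cs \<subseteq> set T" "canon (cs @ bs) S'" "orth S' \<subseteq> orth S"
    unfolding P_def by blast
  have "\<not> chain S' b xs" if b: "b \<in> set T" for b xs
  proof
    assume ch: "chain S' b xs"
    obtain a k \<theta> where bb: "b = (a, k, \<theta>)" by (cases b)
    from canon_extend_chain[OF cs(3) ch[unfolded bb]] obtain S''
      where S'': "canon ((a, k, \<theta>) # cs @ bs) S''" "orth S'' \<subseteq> orth S'" by blast
    have "P (Suc l)" unfolding P_def
      using S'' cs b bb by (intro exI[of _ "b # cs"] exI[of _ S'']) auto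
    then show False using max by force
  qed
  with cs show thesis using that by blast
qed

section \<open>Nilpotent operators with nonnegative square\<close>

lemma A_add: "x \<in> carrier_vec n \<Longrightarrow> y \<in> carrier_vec n \<Longrightarrow> A *\<^sub>v (x + y) = A *\<^sub>v x + A *\<^sub>v y"
  by (rule mult_add_distrib_mat_vec[OF A])

lemma A_smult: "x \<in> carrier_vec n \<Longrightarrow> A *\<^sub>v (c \<cdot>\<^sub>v x) = c \<cdot>\<^sub>v (A *\<^sub>v x)"
  by (rule mult_mat_vec[OF A])

lemmas ip_expand = ip_add_left ip_add_right ip_smult_left ip_smult_right

text \<open>The usual polarization with \<open>y\<close> and \<open>\<i> y\<close>.  It is needed for \<open>f\<close> the identity and for
  \<open>f\<close> the action of \<open>A\<close>, inside the complement of a partial canonical basis.\<close>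

lemma polarization:
  assumes S: "S \<in> carrier_mat n k"
    and f: "\<And>x. x \<in> carrier_vec n \<Longrightarrow> f x \<in> carrier_vec n"
      "\<And>x y. x \<in> carrier_vec n \<Longrightarrow> y \<in> carrier_vec n \<Longrightarrow> f (x + y) = f x + f y"
      "\<And>c x. x \<in> carrier_vec n \<Longrightarrow> f (c \<cdot>\<^sub>v x) = c \<cdot>\<^sub>v f x"
    and x: "x \<in> orth S" and y: "y \<in> orth S" and ne: "ip (f x) y \<noteq> 0"
  obtains w where "w \<in> orth S" "ip (f w) w \<noteq> 0"
proof (rule ccontr)
  assume "\<not> thesis"
  with that have z: "ip (f w) w = 0" if "w \<in> orth S" for w using that by blast
  have xc: "x \<in> carrier_vec n" and yc: "y \<in> carrier_vec n" using x y orth_carrier by auto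
  have iy: "\<i> \<cdot>\<^sub>v y \<in> orth S" by (rule orth_smult[OF S y])
  have "ip (f (x + y)) (x + y) = 0" "ip (f (x + \<i> \<cdot>\<^sub>v y)) (x + \<i> \<cdot>\<^sub>v y) = 0"
    using z orth_add[OF S x y] orth_add[OF S x iy] by auto
  then have "ip (f x) y + ip (f y) x = 0" "\<i> * ip (f y) x - \<i> * ip (f x) y = 0"
    using xc yc z[OF x] z[OF y] by (simp_all add: f ip_expand algebra_simps)
  then have "ip (f x) y = 0" by (simp add: algebra_simps)
  with ne show False by simp
qed

text \<open>Isotropic vectors of a positive semidefinite form are in its kernel.  Otherwise some \<open>y\<close> has
  \<open>b = [A\<^sup>2w, y] \<noteq> 0\<close>, and moving from \<open>w\<close> a little in the direction \<open>-b y\<close> makes the form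
  negative.\<close>

lemma psd_null:
  assumes pos: "\<And>x. x \<in> carrier_vec n \<Longrightarrow> 0 \<le> ip (A *\<^sub>v (A *\<^sub>v x)) x"
    and w: "w \<in> carrier_vec n" and z: "ip (A *\<^sub>v (A *\<^sub>v w)) w = 0"
  shows "A *\<^sub>v (A *\<^sub>v w) = 0\<^sub>v n"
proof (rule ip_null)
  fix y :: "complex vec" assume y: "y \<in> carrier_vec n"
  let ?B = "\<lambda>x. A *\<^sub>v (A *\<^sub>v x)"
  define b where "b = ip (?B w) y"
  have b': "ip (?B y) w = cnj b" unfolding b_def
    using w y ip_commute[of "?B w" y] by (simp add: ip_self)
  define g where "g = Re (ip (?B y) y)"
  have g: "ip (?B y) y = complex_of_real g" "0 \<le> g"
    using pos[OF y] by (auto simp: g_def less_eq_complex_def complex_eq_iff)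
  \<comment> \<open>Any \<open>r > 0\<close> with \<open>r g < 2\<close> would do.\<close>
  define r where "r = 1 / (g + 1)"
  have r: "0 < r" "r * g < 1" using g(2) by (auto simp: r_def)
  define t where "t = - complex_of_real r * b"
  have "ip (?B (w + t \<cdot>\<^sub>v y)) (w + t \<cdot>\<^sub>v y) = cnj t * b + t * cnj b + t * cnj t * g"
    using w y z by (simp add: A_add A_smult ip_expand b' g(1) flip: b_def) (simp add: algebra_simps)
  also have "\<dots> = complex_of_real ((r * g - 2) * r * (cmod b)\<^sup>2)"
    unfolding t_def of_real_mult of_real_power[symmetric]
    by (simp only: complex_norm_square) (simp add: algebra_simps)
  finally have "0 \<le> (r * g - 2) * r * (cmod b)\<^sup>2"
    using pos[of "w + t \<cdot>\<^sub>v y"] w y by (simp add: less_eq_complex_def)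
  moreover have "(r * g - 2) * r < 0" using r by (simp add: mult_neg_pos)
  ultimately have "(cmod b)\<^sup>2 \<le> 0" by (meson mult_neg_pos not_le)
  then show "ip (?B w) y = 0" by (simp add: b_def)
qed (use w in auto)

lemma ip_real:
  assumes "x \<in> carrier_vec n" "y \<in> carrier_vec n" "ip y x = ip x y"
  shows "cnj (ip x y) = ip x y"
  using ip_commute[OF assms(1,2)] assms(3) by simp

text \<open>Scaling a vector by \<open>s\<close> multiplies its square \<open>c\<close> by \<open>s\<^sup>2\<close>.\<close>

lemma normalise:
  fixes c :: complex
  assumes "cnj c = c" "c \<noteq> 0"
  obtains s \<theta> :: complex where "cnj s = s" "s * s * c = \<theta>" "\<theta> = 1 \<or> \<theta> = -1" "0 \<le> c \<Longrightarrow> \<theta> = 1"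
proof -
  obtain r where r: "c = complex_of_real r" using assms(1) by (metis Reals_cases Reals_cnj_iff)
  have r0: "r \<noteq> 0" using assms(2) r by simp
  have "1 / sqrt \<bar>r\<bar> * (1 / sqrt \<bar>r\<bar>) * r = sgn r"
    using r0 by (simp add: sgn_if)
  then have "complex_of_real (1 / sqrt \<bar>r\<bar>) * complex_of_real (1 / sqrt \<bar>r\<bar>) * c = complex_of_real (sgn r)"
    unfolding r of_real_mult[symmetric] by simp
  moreover have "complex_of_real (sgn r) = 1 \<or> complex_of_real (sgn r) = -1"
    using r0 by (simp add: sgn_if)
  moreover have "0 \<le> c \<Longrightarrow> complex_of_real (sgn r) = 1"
    using r0 by (simp add: r less_eq_complex_def)
  ultimately show thesis using that[of "complex_of_real (1 / sqrt \<bar>r\<bar>)"] by simp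
qed

lemma zero_smult [simp]: "x \<in> carrier_vec n \<Longrightarrow> (0::complex) \<cdot>\<^sub>v x = 0\<^sub>v n"
  by (intro eq_vecI) auto

lemma smult_zero [simp]: "c \<cdot>\<^sub>v 0\<^sub>v n = (0\<^sub>v n :: complex vec)"
  by (intro eq_vecI) auto

lemma A_zero [simp]: "A *\<^sub>v 0\<^sub>v n = 0\<^sub>v n"
  by (rule mult_mat_vec_null[OF A])

text \<open>A vector \<open>w\<close> with \<open>A\<^sup>2w \<noteq> 0\<close> generates a block of size \<open>3\<close> with sign \<open>+1\<close>: nonnegativity gives
  \<open>[A\<^sup>2w, w] > 0\<close>, and \<open>A\<^sup>3w = 0\<close> because \<open>[A\<^sup>2(Aw), Aw] = [A\<^sup>4w, w] = 0\<close>.\<close>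

lemma chain3:
  assumes can: "canon bs S" and w: "w \<in> orth S"
    and pos: "\<And>x. x \<in> carrier_vec n \<Longrightarrow> 0 \<le> ip (A *\<^sub>v (A *\<^sub>v x)) x"
    and nil: "A *\<^sub>v (A *\<^sub>v (A *\<^sub>v (A *\<^sub>v w))) = 0\<^sub>v n"
    and ne: "A *\<^sub>v (A *\<^sub>v w) \<noteq> 0\<^sub>v n"
  shows "\<exists>xs. chain S (0, 3, 1) xs"
proof -
  have S: "S \<in> carrier_mat n (bsize bs)" using can by simp
  have wc: "w \<in> carrier_vec n" by (rule orth_carrier[OF w])
  have "ip (A *\<^sub>v (A *\<^sub>v w)) w \<noteq> 0" using psd_null[OF pos wc] ne by blast
  moreover have "0 \<le> ip (A *\<^sub>v (A *\<^sub>v w)) w" by (rule pos[OF wc])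
  moreover from this have "cnj (ip (A *\<^sub>v (A *\<^sub>v w)) w) = ip (A *\<^sub>v (A *\<^sub>v w)) w"
    by (simp add: less_eq_complex_def complex_eq_iff)
  ultimately obtain s where s: "cnj s = s" "s * s * ip (A *\<^sub>v (A *\<^sub>v w)) w = 1"
    using normalise by metis
  define u0 where "u0 = s \<cdot>\<^sub>v w"
  define u1 where "u1 = A *\<^sub>v u0"
  define u2 where "u2 = A *\<^sub>v u1"
  have u0: "u0 \<in> orth S" unfolding u0_def by (rule orth_smult[OF S w])
  have u1: "u1 \<in> orth S" unfolding u1_def by (rule orth_A[OF can u0])
  have u2: "u2 \<in> orth S" unfolding u2_def by (rule orth_A[OF can u1])
  have c [simp]: "u0 \<in> carrier_vec n" "u1 \<in> carrier_vec n" "u2 \<in> carrier_vec n"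
    using u0 u1 u2 orth_carrier by auto
  have A4: "A *\<^sub>v (A *\<^sub>v u2) = 0\<^sub>v n"
    unfolding u2_def u1_def u0_def using wc nil by (simp add: A_smult)
  have "A *\<^sub>v (A *\<^sub>v u1) = 0\<^sub>v n"
  proof (rule psd_null[OF pos])
    have "ip (A *\<^sub>v (A *\<^sub>v u1)) u1 = ip (A *\<^sub>v u2) (A *\<^sub>v u0)" by (simp add: u2_def u1_def)
    also have "\<dots> = ip (A *\<^sub>v (A *\<^sub>v u2)) u0" by (simp add: ip_self)
    finally show "ip (A *\<^sub>v (A *\<^sub>v u1)) u1 = 0" by (simp add: A4)
  qed auto
  then have Au2 [simp]: "A *\<^sub>v u2 = 0\<^sub>v n" by (simp add: u2_def)
  have Au0 [simp]: "A *\<^sub>v u0 = u1" and Au1 [simp]: "A *\<^sub>v u1 = u2" by (simp_all add: u1_def u2_def)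
  have i20 [simp]: "ip u2 u0 = 1" using s wc by (simp add: u0_def u1_def u2_def A_smult ip_expand mult_ac)
  have i11 [simp]: "ip u1 u1 = 1" using i20 ip_self[of u1 u0] by simp
  have i02 [simp]: "ip u0 u2 = 1" using i11 ip_self[of u0 u1] by simp
  have i21 [simp]: "ip u2 u1 = 0" using ip_self[of u2 u0] by simp
  have i12 [simp]: "ip u1 u2 = 0" using i21 ip_commute[of u2 u1] by simp
  have i22 [simp]: "ip u2 u2 = 0" using ip_self[of u2 u1] by simp
  define g where "g = ip u1 u0"
  have g1: "ip u0 u1 = g" using ip_self[of u0 u0] by (simp add: g_def)
  have g [simp]: "cnj g = g" using ip_real[of u1 u0] g1 by (simp add: g_def)
  define h where "h = ip u0 u0"
  have h [simp]: "cnj h = h" using ip_real[of u0 u0] by (simp add: h_def)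
  \<comment> \<open>Adding \<open>\<alpha> Aw + \<beta> A\<^sup>2w\<close> to \<open>w\<close> changes \<open>[Aw, w]\<close> by \<open>2\<alpha>\<close>, and \<open>[w, w]\<close> by
    \<open>2\<alpha>g + \<alpha>\<^sup>2 + 2\<beta>\<close>; both are made zero.\<close>
  define al where "al = - g / 2"
  define be where "be = - (h + 2 * al * g + al * al) / 2"
  have al [simp]: "cnj al = al" and be [simp]: "cnj be = be" by (simp_all add: al_def be_def)
  define x where "x = u0 + (al \<cdot>\<^sub>v u1 + be \<cdot>\<^sub>v u2)"
  have x: "x \<in> orth S" unfolding x_def by (intro orth_add[OF S] orth_smult[OF S] u0 u1 u2)
  have Ax: "A *\<^sub>v x = u1 + al \<cdot>\<^sub>v u2" unfolding x_def by (simp add: A_add A_smult)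
  have A2x: "A *\<^sub>v (u1 + al \<cdot>\<^sub>v u2) = u2" by (simp add: A_add A_smult)
  have xc [simp]: "x \<in> carrier_vec n" using orth_carrier[OF x] .
  have gr: "ip x x = 0" "ip x (u1 + al \<cdot>\<^sub>v u2) = 0" "ip (u1 + al \<cdot>\<^sub>v u2) x = 0"
    "ip (u1 + al \<cdot>\<^sub>v u2) (u1 + al \<cdot>\<^sub>v u2) = 1" "ip u2 x = 1" "ip x u2 = 1"
    "ip u2 (u1 + al \<cdot>\<^sub>v u2) = 0" "ip (u1 + al \<cdot>\<^sub>v u2) u2 = 0"
    unfolding x_def by (simp_all add: ip_expand g1 g_def[symmetric] h_def[symmetric] algebra_simps)
      (simp_all add: be_def al_def field_simps)
  have "u1 + al \<cdot>\<^sub>v u2 \<in> orth S" by (intro orth_add[OF S] orth_smult[OF S] u1 u2)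
  then have "chain S (0, 3, 1) [u2, u1 + al \<cdot>\<^sub>v u2, x]"
    using x u2 by (simp add: chain_def numeral_3_eq_3 All_less_Suc gr Ax A2x)
  then show ?thesis by blast
qed

text \<open>When \<open>A\<^sup>2 = 0\<close> on the complement but \<open>A \<noteq> 0\<close>, nondegeneracy and polarization provide \<open>v\<close> with
  \<open>[Av, v] \<noteq> 0\<close>.  The sign is that of \<open>[Av, v]\<close> and may be negative.\<close>

lemma chain2:
  assumes can: "canon bs S" and sg: "signed bs" and w: "w \<in> orth S"
    and nil: "\<And>x. x \<in> orth S \<Longrightarrow> A *\<^sub>v (A *\<^sub>v x) = 0\<^sub>v n"
    and ne: "A *\<^sub>v w \<noteq> 0\<^sub>v n"
  shows "\<exists>xs \<theta>. (\<theta> = 1 \<or> \<theta> = -1) \<and> chain S (0, 2, \<theta>) xs"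
proof -
  have S: "S \<in> carrier_mat n (bsize bs)" using can by simp
  obtain y where y: "y \<in> orth S" "ip (A *\<^sub>v w) y \<noteq> 0"
    using orth_nondegenerate[OF can sg orth_A[OF can w]] ne by blast
  obtain v where v: "v \<in> orth S" "ip (A *\<^sub>v v) v \<noteq> 0"
    using polarization[OF S, of "\<lambda>x. A *\<^sub>v x", OF _ A_add A_smult w y] by auto
  have vc: "v \<in> carrier_vec n" by (rule orth_carrier[OF v(1)])
  have "cnj (ip (A *\<^sub>v v) v) = ip (A *\<^sub>v v) v" using ip_real[of "A *\<^sub>v v" v] vc by (simp add: ip_self)
  then obtain s \<theta> where s: "cnj s = s" "s * s * ip (A *\<^sub>v v) v = \<theta>" and \<theta>: "\<theta> = 1 \<or> \<theta> = -1"
    using normalise[OF _ v(2)] by metis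
  define u0 where "u0 = s \<cdot>\<^sub>v v"
  define u1 where "u1 = A *\<^sub>v u0"
  have u0: "u0 \<in> orth S" unfolding u0_def by (rule orth_smult[OF S v(1)])
  have u1: "u1 \<in> orth S" unfolding u1_def by (rule orth_A[OF can u0])
  have c [simp]: "u0 \<in> carrier_vec n" "u1 \<in> carrier_vec n"
    using u0 u1 orth_carrier by auto
  have Au1 [simp]: "A *\<^sub>v u1 = 0\<^sub>v n" unfolding u1_def by (rule nil[OF u0])
  have Au0 [simp]: "A *\<^sub>v u0 = u1" by (simp add: u1_def)
  have i10 [simp]: "ip u1 u0 = \<theta>" using s vc by (simp add: u0_def u1_def A_smult ip_expand mult_ac)
  have i01 [simp]: "ip u0 u1 = \<theta>" using i10 ip_self[of u0 u0] by simp
  have i11 [simp]: "ip u1 u1 = 0" using ip_self[of u1 u0] by simp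
  define h where "h = ip u0 u0"
  have h [simp]: "cnj h = h" using ip_real[of u0 u0] by (simp add: h_def)
  \<comment> \<open>Adding \<open>\<alpha> Av\<close> changes \<open>[v, v]\<close> by \<open>2\<alpha>\<theta>\<close>, and \<open>\<theta>\<^sup>2 = 1\<close>.\<close>
  define al where "al = - h * \<theta> / 2"
  have al [simp]: "cnj al = al" using \<theta> by (auto simp: al_def)
  define x where "x = u0 + al \<cdot>\<^sub>v u1"
  have x: "x \<in> orth S" unfolding x_def by (intro orth_add[OF S] orth_smult[OF S] u0 u1)
  have Ax: "A *\<^sub>v x = u1" unfolding x_def by (simp add: A_add A_smult)
  have xc [simp]: "x \<in> carrier_vec n" using orth_carrier[OF x] .
  have gr: "ip x x = 0" "ip x u1 = \<theta>" "ip u1 x = \<theta>"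
    unfolding x_def using \<theta> by (auto simp: ip_expand h_def[symmetric] al_def)
  have "chain S (0, 2, \<theta>) [u1, x]"
    using x u1 by (simp add: chain_def numeral_2_eq_2 All_less_Suc gr Ax)
  then show ?thesis using \<theta> by blast
qed

lemma chain1:
  assumes can: "canon bs S" and sg: "signed bs" and w: "w \<in> orth S"
    and nil: "\<And>x. x \<in> orth S \<Longrightarrow> A *\<^sub>v x = 0\<^sub>v n" and ne: "w \<noteq> 0\<^sub>v n"
  shows "\<exists>xs \<theta>. (\<theta> = 1 \<or> \<theta> = -1) \<and> chain S (0, 1, \<theta>) xs"
proof -
  have S: "S \<in> carrier_mat n (bsize bs)" using can by simp
  obtain y where y: "y \<in> orth S" "ip w y \<noteq> 0"
    using orth_nondegenerate[OF can sg w] ne by blast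
  obtain v where v: "v \<in> orth S" "ip v v \<noteq> 0"
    using polarization[OF S, of "\<lambda>x. x", OF _ _ _ w y] by auto
  have vc: "v \<in> carrier_vec n" by (rule orth_carrier[OF v(1)])
  have "cnj (ip v v) = ip v v" using ip_real[of v v] vc by simp
  then obtain s \<theta> where s: "cnj s = s" "s * s * ip v v = \<theta>" and \<theta>: "\<theta> = 1 \<or> \<theta> = -1"
    using normalise[OF _ v(2)] by metis
  have u: "s \<cdot>\<^sub>v v \<in> orth S" by (rule orth_smult[OF S v(1)])
  have "chain S (0, 1, \<theta>) [s \<cdot>\<^sub>v v]"
    using u nil[OF u] s vc by (simp add: chain_def ip_expand mult_ac)
  then show ?thesis using \<theta> by blast
qed

text \<open>Blocks of size \<open>3\<close>, \<open>2\<close> and \<open>1\<close> are split off in this order.  Once those of size \<open>3\<close> are exhausted,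
  \<open>A\<^sup>2\<close> vanishes on the complement; once those of size \<open>2\<close> are, \<open>A\<close> vanishes; and once those of size
  \<open>1\<close> are, the complement is trivial.\<close>

theorem nilpotent_canonical:
  assumes pos: "\<And>x. x \<in> carrier_vec n \<Longrightarrow> 0 \<le> ip (A *\<^sub>v (A *\<^sub>v x)) x"
    and nil: "\<And>x. x \<in> carrier_vec n \<Longrightarrow> A *\<^sub>v (A *\<^sub>v (A *\<^sub>v (A *\<^sub>v x))) = 0\<^sub>v n"
  obtains cs1 cs2 cs3 S where "set cs1 \<subseteq> {(0, 1, 1), (0, 1, -1)}"
    "set cs2 \<subseteq> {(0, 2, 1), (0, 2, -1)}" "set cs3 \<subseteq> {(0, 3, 1)}"
    "canon (cs1 @ cs2 @ cs3) S" "orth S \<subseteq> {0\<^sub>v n}"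
proof -
  have sgT: "signed []" "signed [(0, 3, 1)]" "signed [(0, 2, 1), (0, 2, -1)]" "signed [(0, 1, 1), (0, 1, -1)]"
    by (auto simp: signed_def)
  obtain cs3 S3 where c3: "set cs3 \<subseteq> set [(0, 3, 1)]" "canon (cs3 @ []) S3" "orth S3 \<subseteq> orth (0\<^sub>m n 0)"
    and m3: "\<And>b xs. b \<in> set [(0, 3, 1)] \<Longrightarrow> \<not> chain S3 b xs"
    by (rule canon_maximal[OF canon_Nil sgT(1,2)]) (rule that; assumption)
  have cs3: "set cs3 \<subseteq> {(0, 3, 1)}" "canon cs3 S3" and max3: "\<And>xs. \<not> chain S3 (0, 3, 1) xs"
    using c3 m3 by simp_all
  have A2: "A *\<^sub>v (A *\<^sub>v x) = 0\<^sub>v n" if "x \<in> orth S3" for x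
    using chain3[OF cs3(2) that pos nil[OF orth_carrier[OF that]]] max3 by blast
  have sg3: "signed cs3" using cs3(1) by (auto simp: signed_def)
  obtain cs2 S2 where
    c2: "set cs2 \<subseteq> set [(0, 2, 1), (0, 2, -1)]" "canon (cs2 @ cs3) S2" "orth S2 \<subseteq> orth S3"
    and m2: "\<And>b xs. b \<in> set [(0, 2, 1), (0, 2, -1)] \<Longrightarrow> \<not> chain S2 b xs"
    by (rule canon_maximal[OF cs3(2) sg3 sgT(3)]) (rule that; assumption)
  then have cs2: "set cs2 \<subseteq> {(0, 2, 1), (0, 2, -1)}" "canon (cs2 @ cs3) S2" "orth S2 \<subseteq> orth S3"
    and max2: "\<And>xs. \<not> chain S2 (0, 2, 1) xs" "\<And>xs. \<not> chain S2 (0, 2, -1) xs"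
    by simp_all
  have sg2: "signed (cs2 @ cs3)" using cs3(1) cs2(1) by (auto simp: signed_def)
  have A1: "A *\<^sub>v x = 0\<^sub>v n" if "x \<in> orth S2" for x
    using chain2[OF cs2(2) sg2 that] A2 cs2(3) max2 by blast
  obtain cs1 S1 where
    c1: "set cs1 \<subseteq> set [(0, 1, 1), (0, 1, -1)]" "canon (cs1 @ cs2 @ cs3) S1" "orth S1 \<subseteq> orth S2"
    and m1: "\<And>b xs. b \<in> set [(0, 1, 1), (0, 1, -1)] \<Longrightarrow> \<not> chain S1 b xs"
    by (rule canon_maximal[OF cs2(2) sg2 sgT(4)]) (rule that; assumption)
  then have cs1: "set cs1 \<subseteq> {(0, 1, 1), (0, 1, -1)}" "canon (cs1 @ cs2 @ cs3) S1" "orth S1 \<subseteq> orth S2"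
    and max1: "\<And>xs. \<not> chain S1 (0, 1, 1) xs" "\<And>xs. \<not> chain S1 (0, 1, -1) xs"
    by simp_all
  have sg1: "signed (cs1 @ cs2 @ cs3)" using cs3(1) cs2(1) cs1(1) by (auto simp: signed_def)
  have "x = 0\<^sub>v n" if "x \<in> orth S1" for x
    using chain1[OF cs1(2) sg1 that] A1 cs1(3) max1 by blast
  then have "orth S1 \<subseteq> {0\<^sub>v n}" by blast
  with cs1 cs2 cs3 show thesis using that by blast
qed

end

section \<open>Hermitian square roots of a positive diagonal matrix\<close>

text \<open>The eigenvectors for negative eigenvalues are split off before those for positive eigenvalues.  Then
  the complement contains no eigenvectors of \<open>A\<close> for any \<open>\<plusminus>\<surd>\<lambda>\<^sub>i\<close>, and the remaining task is to show
  that an invariant subspace without such eigenvectors is trivial.\<close>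

theorem definite_canonical:
  fixes A :: "complex mat" and lam :: "nat \<Rightarrow> real"
  assumes A: "A \<in> carrier_mat q q" and adj: "mat_adjoint A = A"
    and sq: "A * A = mat q q (\<lambda>(i, j). if i = j then complex_of_real (lam i) else 0)"
    and lam: "\<And>i. i < q \<Longrightarrow> 0 < lam i"
  obtains cp cm S where
    "set cp \<subseteq> (\<lambda>i. (complex_of_real (sqrt (lam i)), 1, 1)) ` {..<q}"
    "set cm \<subseteq> (\<lambda>i. (- complex_of_real (sqrt (lam i)), 1, 1)) ` {..<q}"
    "selfadjoint_pair.canon q (1\<^sub>m q) A (cp @ cm) S"
    "selfadjoint_pair.orth q (1\<^sub>m q) S \<subseteq> {0\<^sub>v q}"
proof -
  interpret selfadjoint_pair q "1\<^sub>m q" A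
    by unfold_locales (use A adj in \<open>auto intro!: bexI[of _ "1\<^sub>m q"]\<close>)
  have chain: "\<exists>xs. chain S (a, 1, 1) xs"
    if S: "S \<in> carrier_mat q k" and w: "w \<in> orth S" and ne: "w \<noteq> 0\<^sub>v q" and Aw: "A *\<^sub>v w = a \<cdot>\<^sub>v w"
    for S k w a
  proof -
    have wc: "w \<in> carrier_vec q" by (rule orth_carrier[OF w])
    have "0 < ip w w" unfolding indef_prod_def using wc ne by simp
    then have "0 \<le> ip w w" "ip w w \<noteq> 0" "cnj (ip w w) = ip w w"
      by (auto simp: less_complex_def less_eq_complex_def complex_eq_iff)
    then obtain s where s: "cnj s = s" "s * s * ip w w = 1" using normalise by metis
    have u: "s \<cdot>\<^sub>v w \<in> orth S" by (rule orth_smult[OF S w])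
    have "chain S (a, 1, 1) [s \<cdot>\<^sub>v w]"
      using u s wc by (simp add: chain_def ip_expand A_smult Aw smult_smult_assoc mult_ac)
    then show ?thesis by blast
  qed
  let ?Tm = "map (\<lambda>i. (- complex_of_real (sqrt (lam i)), 1, 1)) [0..<q]"
  let ?Tp = "map (\<lambda>i. (complex_of_real (sqrt (lam i)), 1, 1)) [0..<q]"
  have sgT: "signed ?Tm" "signed ?Tp" "signed []" by (auto simp: signed_def)
  obtain cm Sm where cm': "set cm \<subseteq> set ?Tm" "canon (cm @ []) Sm" "orth Sm \<subseteq> orth (0\<^sub>m q 0)"
    and maxm: "\<And>b xs. b \<in> set ?Tm \<Longrightarrow> \<not> chain Sm b xs"
    by (rule canon_maximal[OF canon_Nil sgT(3,1)]) (rule that; assumption)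
  then have cm: "set cm \<subseteq> set ?Tm" "canon cm Sm" by simp_all
  have sgm: "signed cm" using cm(1) by (auto simp: signed_def)
  obtain cp S where cp: "set cp \<subseteq> set ?Tp" "canon (cp @ cm) S" "orth S \<subseteq> orth Sm"
    and maxp: "\<And>b xs. b \<in> set ?Tp \<Longrightarrow> \<not> chain S b xs"
    by (rule canon_maximal[OF cm(2) sgm sgT(2)]) (rule that; assumption)
  have S: "S \<in> carrier_mat q (bsize (cp @ cm))" by (rule canon_carrier[OF cp(2)])
  have Sm: "Sm \<in> carrier_mat q (bsize cm)" using cm(2) by simp
  have noeig: "w = 0\<^sub>v q"
    if w: "w \<in> orth S" and i: "i < q"
      and e: "A *\<^sub>v w = complex_of_real (sqrt (lam i)) \<cdot>\<^sub>v w \<or> A *\<^sub>v w = - complex_of_real (sqrt (lam i)) \<cdot>\<^sub>v w" for w i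
  proof (rule ccontr)
    assume ne: "w \<noteq> 0\<^sub>v q"
    have mem: "(complex_of_real (sqrt (lam i)), 1, 1) \<in> set ?Tp"
      "(- complex_of_real (sqrt (lam i)), 1, 1) \<in> set ?Tm"
      using i by simp_all
    from e show False
    proof
      assume "A *\<^sub>v w = complex_of_real (sqrt (lam i)) \<cdot>\<^sub>v w"
      from chain[OF S w ne this] maxp[OF mem(1)] show False by blast
    next
      assume "A *\<^sub>v w = - complex_of_real (sqrt (lam i)) \<cdot>\<^sub>v w"
      from chain[OF Sm subsetD[OF cp(3) w] ne this] maxm[OF mem(2)] show False by blast
    qed
  qed
  have A2: "(A *\<^sub>v (A *\<^sub>v w)) = vec q (\<lambda>i. complex_of_real (lam i) * w $ i)" if "w \<in> carrier_vec q" for w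
  proof -
    have "A *\<^sub>v (A *\<^sub>v w) = mat q q (\<lambda>(i, j). if i = j then complex_of_real (lam i) else 0) *\<^sub>v w"
      using that A by (simp add: assoc_mult_mat_vec[of _ q q _ q, symmetric] sq)
    also have "\<dots> = vec q (\<lambda>i. complex_of_real (lam i) * w $ i)"
      using that by (intro eq_vecI) (auto simp: scalar_prod_def if_distrib[of "\<lambda>x. x * _"] cong: if_cong)
    finally show ?thesis .
  qed
  \<comment> \<open>Take \<open>w\<close> with \<open>w\<^sub>i \<noteq> 0\<close>.  The vector \<open>(A\<^sup>2 - \<lambda>\<^sub>i) w\<close> is again in the complement and has smaller
    support, so it vanishes by induction.  Then \<open>(A - \<surd>\<lambda>\<^sub>i) w\<close> satisfies the eigenvector equation
    for \<open>-\<surd>\<lambda>\<^sub>i\<close>, hence vanishes, and so \<open>w\<close> satisfies that for \<open>\<surd>\<lambda>\<^sub>i\<close>.\<close>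
  have zero: "w = 0\<^sub>v q" if "w \<in> orth S" for w
    using that
  proof (induction "card {i. i < q \<and> w $ i \<noteq> 0}" arbitrary: w rule: less_induct)
    case less
    have wc: "w \<in> carrier_vec q" by (rule orth_carrier[OF less.prems])
    show ?case
    proof (rule ccontr)
      assume "w \<noteq> 0\<^sub>v q"
      then obtain i where i: "i < q" "w $ i \<noteq> 0" using wc by (metis carrier_vecD eq_vecI index_zero_vec)
      define mu where "mu = complex_of_real (sqrt (lam i))"
      have mu2: "mu * mu = complex_of_real (lam i)"
        using lam[OF i(1)] by (simp add: mu_def flip: of_real_mult)
      define v where "v = A *\<^sub>v (A *\<^sub>v w) + (- (mu * mu)) \<cdot>\<^sub>v w"
      have v: "v \<in> orth S" unfolding v_def
        by (intro orth_add[OF S] orth_smult[OF S] orth_A[OF cp(2)] less.prems)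
      have vi: "v $ j = complex_of_real (lam j - lam i) * w $ j" if "j < q" for j
        using that wc by (simp add: v_def A2 mu2 algebra_simps)
      have "{j. j < q \<and> v $ j \<noteq> 0} \<subset> {j. j < q \<and> w $ j \<noteq> 0}"
      proof
        show "{j. j < q \<and> v $ j \<noteq> 0} \<subseteq> {j. j < q \<and> w $ j \<noteq> 0}"
        proof
          fix j assume "j \<in> {j. j < q \<and> v $ j \<noteq> 0}"
          then have "j < q" "v $ j \<noteq> 0" by simp_all
          then show "j \<in> {j. j < q \<and> w $ j \<noteq> 0}" using vi[of j] by simp
        qed
        have "v $ i = 0" using vi[OF i(1)] by simp
        then have "i \<notin> {j. j < q \<and> v $ j \<noteq> 0}" by blast
        moreover have "i \<in> {j. j < q \<and> w $ j \<noteq> 0}" using i by blast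
        ultimately show "{j. j < q \<and> v $ j \<noteq> 0} \<noteq> {j. j < q \<and> w $ j \<noteq> 0}" by blast
      qed
      then have "card {j. j < q \<and> v $ j \<noteq> 0} < card {j. j < q \<and> w $ j \<noteq> 0}"
        by (intro psubset_card_mono) auto
      then have v0: "v = 0\<^sub>v q" using less.hyps[OF _ v] by blast
      have A2w: "A *\<^sub>v (A *\<^sub>v w) = (mu * mu) \<cdot>\<^sub>v w"
      proof (rule eq_vecI)
        fix j assume "j < dim_vec ((mu * mu) \<cdot>\<^sub>v w)"
        then have j: "j < q" using wc by simp
        have "v $ j = 0" using v0 j by simp
        then show "(A *\<^sub>v (A *\<^sub>v w)) $ j = ((mu * mu) \<cdot>\<^sub>v w) $ j"
          using j wc by (simp add: v_def del: index_mult_mat_vec)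
      qed (use wc in auto)
      define y where "y = A *\<^sub>v w + (- mu) \<cdot>\<^sub>v w"
      have y: "y \<in> orth S" unfolding y_def
        by (intro orth_add[OF S] orth_smult[OF S] orth_A[OF cp(2)] less.prems)
      have "A *\<^sub>v y = - mu \<cdot>\<^sub>v y"
      proof -
        have "A *\<^sub>v y = (mu * mu) \<cdot>\<^sub>v w + (- mu) \<cdot>\<^sub>v (A *\<^sub>v w)"
          unfolding y_def using wc by (simp add: A_add A_smult A2w)
        also have "\<dots> = - mu \<cdot>\<^sub>v y"
          unfolding y_def using wc by (intro eq_vecI) (auto simp: algebra_simps simp del: index_mult_mat_vec)
        finally show ?thesis .
      qed
      then have y0: "y = 0\<^sub>v q" using noeig[OF y i(1)] by (simp add: mu_def)
      have "A *\<^sub>v w = mu \<cdot>\<^sub>v w"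
      proof (rule eq_vecI)
        fix j assume "j < dim_vec (mu \<cdot>\<^sub>v w)"
        then have j: "j < q" using wc by simp
        have "y $ j = 0" using y0 j by simp
        then show "(A *\<^sub>v w) $ j = (mu \<cdot>\<^sub>v w) $ j"
          using j wc by (simp add: y_def del: index_mult_mat_vec)
      qed (use wc in auto)
      then have "w = 0\<^sub>v q" using noeig[OF less.prems i(1)] by (simp add: mu_def)
      with \<open>w \<noteq> 0\<^sub>v q\<close> show False ..
    qed
  qed
  show thesis
    by (rule that[of cp cm S]) (use cp cm zero in auto)
qed

section \<open>Comparing the Jordan structures of a matrix and its square\<close>

lemma jblocks_jordan_matrix: "jblocks bs = jordan_matrix (map (\<lambda>(a, k, \<theta>). (k, a)) bs)"
  by (auto simp: jblocks_def jordan_matrix_def comp_def split_def)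

lemma jordan_nf_jblocks:
  assumes "signed bs" "M \<in> carrier_mat n n" "P \<in> carrier_mat n n" "Q \<in> carrier_mat n n"
    "P * Q = 1\<^sub>m n" "Q * P = 1\<^sub>m n" "Q * M * P = jblocks bs"
  shows "jordan_nf M (map (\<lambda>(a, k, \<theta>). (k, a)) bs)"
proof -
  have "M = P * (Q * M * P) * Q"
  proof -
    have "P * (Q * M * P) * Q = (P * Q) * M * (P * Q)"
      using assms(2-4) by (simp add: assoc_mult_mat[of _ n n _ n _ n])
    then show ?thesis using assms by simp
  qed
  then have "M = P * jblocks bs * Q" using assms(7) by simp
  moreover have "jblocks bs \<in> carrier_mat n n" using assms(2-4) by (simp flip: assms(7))
  ultimately have "similar_mat_wit M (jblocks bs) P Q"
    using assms(2-6) by (intro similar_mat_witI[of P Q n]) auto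
  then have "similar_mat M (jblocks bs)" by (auto simp: similar_mat_def)
  moreover have "0 \<notin> fst ` set (map (\<lambda>(a, k, \<theta>). (k, a)) bs)"
    using assms(1) by (force simp: signed_def)
  ultimately show ?thesis by (simp add: jordan_nf_def flip: jblocks_jordan_matrix)
qed

text \<open>Both sides are the dimension of the kernel of \<open>A\<^sup>2 = B\<close>, computed from the two Jordan forms.\<close>

lemma square_root_block_counts:
  fixes A B :: "complex mat"
  assumes A: "A \<in> carrier_mat n n" and B: "B = A * A"
    and nfA: "jordan_nf A n_as" and nfB: "jordan_nf B n_bs"
  shows "(\<Sum>k\<leftarrow>map fst [(k, e)\<leftarrow>n_as. e = 0]. min 2 k) = (\<Sum>k\<leftarrow>map fst [(k, e)\<leftarrow>n_bs. e = 0]. min 1 k)"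
proof -
  have "char_matrix A 0 = A" "char_matrix B 0 = B"
    using A B by (auto simp: char_matrix_def intro!: eq_matI)
  then have "dim_gen_eigenspace A 0 2 = dim_gen_eigenspace B 0 1"
    unfolding dim_gen_eigenspace_def using A B by (simp add: numeral_2_eq_2)
  then show ?thesis by (simp only: dim_gen_eigenspace[OF nfA] dim_gen_eigenspace[OF nfB])
qed

text \<open>Diagonal forms of a matrix agree up to order, since the multiplicity of an eigenvalue is the
  dimension of its eigenspace.\<close>

lemma diagonal_mset:
  fixes xs ys :: "complex list"
  assumes "jordan_nf M (map (Pair 1) xs)" "jordan_nf M (map (Pair 1) ys)"
  shows "mset xs = mset ys"
proof (rule multiset_eqI)
  fix e
  have "dim_gen_eigenspace M e 1 = count (mset zs) e" if "jordan_nf M (map (Pair 1) zs)" for zs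
  proof -
    have "(\<Sum>n\<leftarrow>map fst [(n, e')\<leftarrow>map (Pair 1) zs. e' = e]. min 1 n) = count (mset zs) e"
      by (induction zs) auto
    then show ?thesis by (simp add: dim_gen_eigenspace[OF that])
  qed
  from this[OF assms(1)] this[OF assms(2)] show "count (mset xs) e = count (mset ys) e" by simp
qed

text \<open>In an eigenbasis of \<open>A\<close> the matrix \<open>A\<^sup>2\<close> is diagonal with entries \<open>a\<^sub>i\<^sup>2\<close>, so these are the
  given diagonal entries of \<open>A\<^sup>2\<close> in some order.\<close>

lemma square_eigenvalue_matching:
  fixes A :: "complex mat" and lam :: "nat \<Rightarrow> complex"
  assumes A: "A \<in> carrier_mat q q"
    and sq: "A * A = mat q q (\<lambda>(i, j). if i = j then lam i else 0)"
    and S: "S \<in> carrier_mat q q" "Sinv \<in> carrier_mat q q" "S * Sinv = 1\<^sub>m q" "Sinv * S = 1\<^sub>m q"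
    and diag: "Sinv * A * S = mat q q (\<lambda>(i, j). if i = j then a i else 0)"
  obtains \<pi> where "bij_betw \<pi> {..<q} {..<q}" "\<And>i. i < q \<Longrightarrow> a i * a i = lam (\<pi> i)"
proof -
  let ?D = "\<lambda>f. mat q q (\<lambda>(i, j). if i = j then f i else (0::complex))"
  let ?b = "\<lambda>f. map (\<lambda>i. (f i :: complex, 1 :: nat, 1 :: complex)) [0..<q]"
  have Db: "jblocks (?b f) = ?D f" for f
    by (subst blocks_of_size_one(2)) (auto intro!: eq_matI)
  have sg: "signed (?b f)" for f by (auto simp: signed_def)
  have ms: "map (\<lambda>(a, k, \<theta>). (k, a)) (?b f) = map (Pair 1) (map f [0..<q])" for f :: "nat \<Rightarrow> complex"
    by simp
  have "Sinv * (A * A) * S = (Sinv * A * S) * (Sinv * A * S)"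
  proof -
    have "(Sinv * A * S) * (Sinv * A * S) = Sinv * A * (S * Sinv) * A * S"
      using A S(1,2) by (simp add: assoc_mult_mat[of _ q q _ q _ q])
    also have "\<dots> = Sinv * (A * A) * S"
      unfolding S(3) using A S(1,2) by (simp add: assoc_mult_mat[of _ q q _ q _ q])
    finally show ?thesis by simp
  qed
  also have "\<dots> = ?D (\<lambda>i. a i * a i)"
    unfolding diag by (intro eq_matI) (auto simp: scalar_prod_def if_distrib[of "\<lambda>x. x * _"] cong: if_cong)
  finally have "jordan_nf (A * A) (map (\<lambda>(a, k, \<theta>). (k, a)) (?b (\<lambda>i. a i * a i)))"
    using A by (intro jordan_nf_jblocks[OF sg _ S(1,2,3,4)]) (auto simp: Db[simplified])
  then have "jordan_nf (A * A) (map (Pair 1) (map (\<lambda>i. a i * a i) [0..<q]))"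
    unfolding ms .
  moreover have "jordan_nf (A * A) (map (\<lambda>(a, k, \<theta>). (k, a)) (?b lam))"
    using A by (intro jordan_nf_jblocks[OF sg, of _ q "1\<^sub>m q" "1\<^sub>m q"]) (auto simp: Db[simplified] sq)
  then have "jordan_nf (A * A) (map (Pair 1) (map lam [0..<q]))"
    unfolding ms .
  ultimately have "mset (map (\<lambda>i. a i * a i) [0..<q]) = mset (map lam [0..<q])"
    by (rule diagonal_mset)
  then obtain p where "p permutes {..<length (map lam [0..<q])}"
    "permute_list p (map lam [0..<q]) = map (\<lambda>i. a i * a i) [0..<q]"
    by (rule mset_eq_permutation)
  then have p: "p permutes {..<q}" "permute_list p (map lam [0..<q]) = map (\<lambda>i. a i * a i) [0..<q]"
    by simp_all
  show thesis
  proof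
    show "bij_betw p {..<q} {..<q}" using permutes_imp_bij[OF p(1)] .
    fix i assume i: "i < q"
    have "map (\<lambda>i. a i * a i) [0..<q] ! i = map lam [0..<q] ! p i"
      unfolding p(2)[symmetric] using p(1) i by (simp add: permute_list_nth)
    moreover have "p i < q" using p(1) i permutes_in_image by fastforce
    ultimately show "a i * a i = lam (p i)" using i by simp
  qed
qed

section \<open>Square roots of the canonical form\<close>

lemma diagonal_mult:
  fixes X :: "complex mat"
  shows "X \<in> carrier_mat q m \<Longrightarrow> mat q q (\<lambda>(i, j). if i = j then d i else 0) * X = mat q m (\<lambda>(i, j). d i * X $$ (i, j))"
    and "X \<in> carrier_mat m q \<Longrightarrow> X * mat q q (\<lambda>(i, j). if i = j then d i else 0) = mat m q (\<lambda>(i, j). X $$ (i, j) * d j)"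
  by (intro eq_matI; auto simp: scalar_prod_def if_distrib[of "\<lambda>x. x * _"] if_distrib[of "\<lambda>x. _ * x"] cong: if_cong)+

text \<open>The off-diagonal blocks \<open>A\<^sub>2\<close> and \<open>A\<^sub>3\<close> of \<open>A\<close> intertwine \<open>D\<close> and \<open>N\<close>.  Hence \<open>D\<^sup>2A\<^sub>2 = A\<^sub>2N\<^sup>2 = 0\<close> and
  \<open>A\<^sub>3D\<^sup>2 = N\<^sup>2A\<^sub>3 = 0\<close>, and \<open>D\<^sup>2\<close> is invertible.\<close>

lemma commutant_block_diagonal:
  fixes A N :: "complex mat"
  assumes A: "A \<in> carrier_mat (q + m) (q + m)" and N: "N \<in> carrier_mat m m" and NN: "N * N = 0\<^sub>m m m"
    and d: "\<And>i. i < q \<Longrightarrow> d i \<noteq> 0"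
  defines "D \<equiv> mat q q (\<lambda>(i, j). if i = j then d i else 0)"
  defines "B \<equiv> four_block_mat D (0\<^sub>m q m) (0\<^sub>m m q) N"
  assumes comm: "A * B = B * A"
  obtains A1 A4 where "A1 \<in> carrier_mat q q" "A4 \<in> carrier_mat m m"
    "A = four_block_mat A1 (0\<^sub>m q m) (0\<^sub>m m q) A4"
proof -
  have D: "D \<in> carrier_mat q q" by (simp add: D_def)
  obtain A1 A2 A3 A4 where sp: "split_block A q q = (A1, A2, A3, A4)" by (metis prod_cases4)
  have c: "A1 \<in> carrier_mat q q" "A2 \<in> carrier_mat q m" "A3 \<in> carrier_mat m q" "A4 \<in> carrier_mat m m"
    and Ae: "A = four_block_mat A1 A2 A3 A4"
    using split_block[OF sp, of m m] A by auto
  have AB: "A * B = four_block_mat (A1 * D) (A2 * N) (A3 * D) (A4 * N)"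
    unfolding Ae B_def using c D N by (subst mult_four_block_mat[of _ q q _ m _ m _ _ q _ m]) auto
  have BA: "B * A = four_block_mat (D * A1) (D * A2) (N * A3) (N * A4)"
    unfolding Ae B_def using c D N by (subst mult_four_block_mat[of _ q q _ m _ m _ _ q _ m]) auto
  note eqs = four_block_inject[OF _ _ _ _ _ _ _ _ comm[unfolded AB BA], of q q m m]
  have e2: "A2 * N = D * A2" and e3: "A3 * D = N * A3"
    using eqs c D N by auto
  have "D * (D * A2) = A2 * N * N" using e2 c D N by (simp add: assoc_mult_mat[of D q q A2 m N m, symmetric])
  also have "\<dots> = 0\<^sub>m q m" using c N NN by (simp add: assoc_mult_mat[of A2 q m N m N m])
  finally have z: "D * (D * A2) = 0\<^sub>m q m" .
  have A2z: "A2 = 0\<^sub>m q m"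
  proof (rule eq_matI)
    fix i j assume "i < dim_row (0\<^sub>m q m :: complex mat)" "j < dim_col (0\<^sub>m q m :: complex mat)"
    then have ij: "i < q" "j < m" by auto
    have "(D * (D * A2)) $$ (i, j) = d i * (d i * A2 $$ (i, j))"
      unfolding D_def using c ij by (simp add: diagonal_mult(1)[of _ q m] del: index_mult_mat)
    then show "A2 $$ (i, j) = 0\<^sub>m q m $$ (i, j)" using z d[OF ij(1)] ij by simp
  qed (use c in auto)
  have "A3 * D * D = N * (N * A3)" using e3 c D N by (simp add: assoc_mult_mat[of N m m A3 q D q])
  also have "\<dots> = 0\<^sub>m m q" using c N NN by (simp add: assoc_mult_mat[of N m m N m A3 q, symmetric])
  finally have z: "A3 * D * D = 0\<^sub>m m q" .
  have A3z: "A3 = 0\<^sub>m m q"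
  proof (rule eq_matI)
    fix i j assume "i < dim_row (0\<^sub>m m q :: complex mat)" "j < dim_col (0\<^sub>m m q :: complex mat)"
    then have ij: "i < m" "j < q" by auto
    have "(A3 * D * D) $$ (i, j) = (A3 $$ (i, j) * d j) * d j"
      unfolding D_def using c ij by (simp add: diagonal_mult(2)[of _ m q] del: index_mult_mat)
    then show "A3 $$ (i, j) = 0\<^sub>m m q $$ (i, j)" using z d[OF ij(2)] ij by simp
  qed (use c in auto)
  show thesis using that c(1,4) Ae unfolding A2z A3z by blast
qed

text \<open>The blocks of \<open>B\<close> at the eigenvalue \<open>0\<close>.\<close>

definition null_blocks :: "(nat \<Rightarrow> complex) \<Rightarrow> nat \<Rightarrow> nat \<Rightarrow> block list" where
  "null_blocks eps s t = map (\<lambda>i. (0, 1, eps i)) [0..<s] @ replicate t (0, 2, 1)"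

lemma null_blocks:
  shows "bsize (null_blocks eps s t) = s + 2 * t"
    and "jblocks (null_blocks eps s t)
      = four_block_mat (0\<^sub>m s s) (0\<^sub>m s (2 * t)) (0\<^sub>m (2 * t) s) (jblocks (replicate t (0, 2, 1)))"
    and "gblocks (null_blocks eps s t)
      = four_block_mat (mat s s (\<lambda>(i, j). if i = j then eps i else 0)) (0\<^sub>m s (2 * t))
          (0\<^sub>m (2 * t) s) (gblocks (replicate t (0, 2, 1)))"
proof -
  let ?b1 = "map (\<lambda>i. (0, 1, eps i)) [0..<s] :: block list"
  have b1: "bsize ?b1 = s" "jblocks ?b1 = 0\<^sub>m s s"
    "gblocks ?b1 = mat s s (\<lambda>(i, j). if i = j then eps i else 0)"
    by (subst blocks_of_size_one; auto intro!: eq_matI)+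
  note two = blocks_of_size_two(4)[of t]
  show "bsize (null_blocks eps s t) = s + 2 * t"
    unfolding null_blocks_def by (simp only: bsize_simps b1 two)
  show "jblocks (null_blocks eps s t)
      = four_block_mat (0\<^sub>m s s) (0\<^sub>m s (2 * t)) (0\<^sub>m (2 * t) s) (jblocks (replicate t (0, 2, 1)))"
    "gblocks (null_blocks eps s t)
      = four_block_mat (mat s s (\<lambda>(i, j). if i = j then eps i else 0)) (0\<^sub>m s (2 * t))
          (0\<^sub>m (2 * t) s) (gblocks (replicate t (0, 2, 1)))"
    unfolding null_blocks_def jblocks_append gblocks_append b1 two by simp_all
qed

lemma blocks_of_size_two_carrier:
  "jblocks (replicate t (0, 2, 1)) \<in> carrier_mat (2 * t) (2 * t)"
  "gblocks (replicate t (0, 2, 1)) \<in> carrier_mat (2 * t) (2 * t)"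
  using blocks_of_size_two(4)[of t] by (metis jblocks_carrier gblocks_carrier)+

lemma null_blocks_square_zero:
  "jblocks (null_blocks eps s t) * jblocks (null_blocks eps s t) = 0\<^sub>m (s + 2 * t) (s + 2 * t)"
  by (simp add: null_blocks block_diag_mult blocks_of_size_two_carrier blocks_of_size_two(1))

text \<open>The kernel of the blocks of size \<open>2\<close> is isotropic, so on the kernel of the whole matrix only the
  coordinates of the blocks of size \<open>1\<close> contribute to the form.\<close>

lemma form_on_kernel:
  fixes eps :: "nat \<Rightarrow> complex" and s t :: nat
  defines "bs \<equiv> null_blocks eps s t"
  assumes z: "z \<in> carrier_vec (s + 2 * t)" "jblocks bs *\<^sub>v z = 0\<^sub>v (s + 2 * t)"
    and z': "z' \<in> carrier_vec (s + 2 * t)" "jblocks bs *\<^sub>v z' = 0\<^sub>v (s + 2 * t)"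
  shows "indef_prod (gblocks bs) z z' = (\<Sum>j<s. eps j * z $ j * cnj (z' $ j))"
proof -
  let ?N = "jblocks (replicate t (0, 2, 1))" and ?G = "gblocks (replicate t (0, 2, 1))"
    and ?E = "mat s s (\<lambda>(i, j). if i = j then eps i else 0)"
  note two = blocks_of_size_two[of t] and c = blocks_of_size_two_carrier[of t]
  have J: "jblocks bs = four_block_mat (0\<^sub>m s s) (0\<^sub>m s (2 * t)) (0\<^sub>m (2 * t) s) ?N"
    and H: "gblocks bs = four_block_mat ?E (0\<^sub>m s (2 * t)) (0\<^sub>m (2 * t) s) ?G"
    unfolding bs_def null_blocks by simp_all
  have split: "\<exists>a b. x = a @\<^sub>v b \<and> a \<in> carrier_vec s \<and> b \<in> carrier_vec (2 * t) \<and> ?N *\<^sub>v b = 0\<^sub>v (2 * t)"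
    if x: "x \<in> carrier_vec (s + 2 * t)" "jblocks bs *\<^sub>v x = 0\<^sub>v (s + 2 * t)" for x
  proof -
    define a b where "a = vec_first x s" and "b = vec_last x (2 * t)"
    have ab: "x = a @\<^sub>v b" "a \<in> carrier_vec s" "b \<in> carrier_vec (2 * t)"
      using x(1) by (auto simp: a_def b_def)
    have "0\<^sub>v (s + 2 * t) = (0\<^sub>m s s *\<^sub>v a) @\<^sub>v (?N *\<^sub>v b)"
      using x(2) ab c unfolding J by (simp add: block_diag_vec)
    moreover have "0\<^sub>v (s + 2 * t) = 0\<^sub>v s @\<^sub>v (0\<^sub>v (2 * t) :: complex vec)" by (intro eq_vecI) auto
    moreover have "0\<^sub>m s s *\<^sub>v a \<in> carrier_vec s" by (auto intro: carrier_vecI)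
    ultimately have "?N *\<^sub>v b = 0\<^sub>v (2 * t)" using append_vec_eq[of "0\<^sub>v s" s "0\<^sub>m s s *\<^sub>v a"] by auto
    with ab show ?thesis by blast
  qed
  obtain a b where ab: "z = a @\<^sub>v b" "a \<in> carrier_vec s" "b \<in> carrier_vec (2 * t)" "?N *\<^sub>v b = 0\<^sub>v (2 * t)"
    using split[OF z] by blast
  obtain a' b' where ab': "z' = a' @\<^sub>v b'" "a' \<in> carrier_vec s" "b' \<in> carrier_vec (2 * t)" "?N *\<^sub>v b' = 0\<^sub>v (2 * t)"
    using split[OF z'] by blast
  \<comment> \<open>Isotropy: \<open>b = N g\<close>, hence \<open>g = G N g = N\<^sup>* G g\<close>, and the adjoint moves to \<open>N b' = 0\<close>.\<close>
  define g where "g = ?G *\<^sub>v b"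
  have g: "g \<in> carrier_vec (2 * t)" "?G *\<^sub>v g \<in> carrier_vec (2 * t)" "?N *\<^sub>v g \<in> carrier_vec (2 * t)"
    using c ab(3) by (auto simp: g_def intro!: mult_mat_vec_carrier)
  have "b = (?N * ?G + ?G * ?N) *\<^sub>v b" using ab(3) by (simp add: two(2))
  also have "\<dots> = ?N *\<^sub>v g + ?G *\<^sub>v (?N *\<^sub>v b)"
    using c ab(3) by (simp add: add_mult_distrib_mat_vec[of _ "2*t" "2*t"] g_def)
  also have "\<dots> = ?N *\<^sub>v g" using ab(4) c g by (simp add: mult_mat_vec_null[OF c(2)])
  finally have bN: "b = ?N *\<^sub>v g" .
  have "g = ?G *\<^sub>v (?N *\<^sub>v g)" using bN by (simp add: g_def)
  also have "\<dots> = (?G * ?N) *\<^sub>v g" using c g by simp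
  also have "\<dots> = mat_adjoint ?N *\<^sub>v (?G *\<^sub>v g)" unfolding two(3) using c g
    by (intro assoc_mult_mat_vec[of _ "2*t" "2*t" _ "2*t"]) auto
  finally have "g \<bullet>c b' = (mat_adjoint ?N *\<^sub>v (?G *\<^sub>v g)) \<bullet>c b'" by simp
  also have "\<dots> = (?G *\<^sub>v g) \<bullet>c (?N *\<^sub>v b')"
    using adjoint_vec[of "mat_adjoint ?N" "2*t" "2*t" "?G *\<^sub>v g" b'] c g ab'(3) by simp
  also have "\<dots> = 0" unfolding ab'(4) using g(2) by simp
  finally have iso: "(?G *\<^sub>v b) \<bullet>c b' = 0" by (simp add: g_def)
  have "indef_prod (gblocks bs) z z' = (?E *\<^sub>v a) \<bullet>c a' + (?G *\<^sub>v b) \<bullet>c b'"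
    unfolding indef_prod_def H ab(1) ab'(1) using ab(2,3) ab'(2,3) c g
    by (subst block_diag_vec[of _ s _ "2*t"]) (auto simp: g_def intro!: cscalar_append[of _ s _ _ "2*t"] mult_mat_vec_carrier[of _ s s])
  also have "\<dots> = (\<Sum>j<s. eps j * a $ j * cnj (a' $ j))"
    unfolding iso using ab(2) ab'(2)
    by (simp add: scalar_prod_def atLeast0LessThan if_distrib[of "\<lambda>x. x * _"] cong: if_cong)
  also have "\<dots> = (\<Sum>j<s. eps j * z $ j * cnj (z' $ j))"
    using ab(1,2) ab'(1,2) by (intro sum.cong) auto
  finally show ?thesis .
qed

lemma list_eq_map_upt: "(\<And>i. i < length xs \<Longrightarrow> xs ! i = f i) \<Longrightarrow> xs = map f [0..<length xs]"
  by (intro nth_equalityI) auto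

lemma segre_pairing_of_counts:
  assumes nf: "jordan_nf B n_as"
    and blocks: "mset (map fst (filter (\<lambda>(k, a). a = 0) n_as)) = replicate_mset (l1 + 2 * l2 + l3) 1 + replicate_mset l3 2"
  shows "segre_pairing B (replicate_mset l1 (1, 0) + replicate_mset l2 (1, 1) + replicate_mset l3 (2, 1))"
  unfolding segre_pairing_def
proof
  let ?P = "replicate_mset l1 (1, 0) + replicate_mset l2 (1, 1) + replicate_mset l3 (2, 1) :: (nat \<times> nat) multiset"
  have "filter_mset (\<lambda>k. k \<noteq> 0) (image_mset fst ?P + image_mset snd ?P)
    = replicate_mset (l1 + 2 * l2 + l3) 1 + replicate_mset l3 2"
    by (rule multiset_eqI) (auto simp: )
  then show "\<exists>n_as. jordan_nf B n_as \<and> filter_mset (\<lambda>k. k \<noteq> 0) (image_mset fst ?P + image_mset snd ?P) =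
          mset (map fst (filter (\<lambda>(k, a). a = 0) n_as))"
    using nf blocks by metis
  show "\<forall>(a, b) \<in># ?P. 0 < a \<and> b \<le> a \<and> a - b \<le> 1"
    by (auto split: if_splits simp: in_replicate_mset)
qed

text \<open>The root is unitarily diagonalizable, and its eigenvalues are matched with the \<open>\<lambda>\<^sub>i\<close> by comparing
  the two diagonal forms of the square.\<close>

theorem positive_part:
  fixes A :: "complex mat" and lam :: "nat \<Rightarrow> real"
  assumes A: "A \<in> carrier_mat q q" and adj: "mat_adjoint A = A"
    and sq: "A * A = mat q q (\<lambda>(i, j). if i = j then complex_of_real (lam i) else 0)"
    and lam: "\<And>i. i < q \<Longrightarrow> 0 < lam i"
  obtains \<pi> q1 q2 S Sinv where "q1 + q2 = q" "bij_betw \<pi> {..<q} {..<q}"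
    "S \<in> carrier_mat q q" "Sinv \<in> carrier_mat q q" "S * Sinv = 1\<^sub>m q" "Sinv * S = 1\<^sub>m q"
    "Sinv * A * S = jblocks (map (\<lambda>i. (complex_of_real (sqrt (lam (\<pi> i))), 1, 1)) [0..<q1] @
       map (\<lambda>i. (- complex_of_real (sqrt (lam (\<pi> (q1 + i)))), 1, 1)) [0..<q2])"
    "mat_adjoint S * 1\<^sub>m q * S = gblocks (map (\<lambda>i. (complex_of_real (sqrt (lam (\<pi> i))), 1, 1)) [0..<q1] @
       map (\<lambda>i. (- complex_of_real (sqrt (lam (\<pi> (q1 + i)))), 1, 1)) [0..<q2])"
proof -
  note A_one = left_mult_one_mat[OF A] right_mult_one_mat[OF A]
  interpret P: selfadjoint_pair q "1\<^sub>m q" A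
    by unfold_locales (use adj A in \<open>auto simp: A_one intro!: bexI[of _ "1\<^sub>m q"]\<close>)
  obtain cp cm S where cp: "set cp \<subseteq> (\<lambda>i. (complex_of_real (sqrt (lam i)), 1, 1)) ` {..<q}"
    and cm: "set cm \<subseteq> (\<lambda>i. (- complex_of_real (sqrt (lam i)), 1, 1)) ` {..<q}"
    and can: "P.canon (cp @ cm) S" and triv: "P.orth S \<subseteq> {0\<^sub>v q}"
    using definite_canonical[OF A adj sq lam] by blast
  have sg: "signed (cp @ cm)" using cp cm by (auto simp: signed_def)
  obtain Sinv where sz: "bsize (cp @ cm) = q" and S: "S \<in> carrier_mat q q" "Sinv \<in> carrier_mat q q"
    and inv: "S * Sinv = 1\<^sub>m q" "Sinv * S = 1\<^sub>m q" and AP: "Sinv * A * S = jblocks (cp @ cm)"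
    using P.canon_complete[OF can sg triv] by blast
  define q1 q2 where "q1 = length cp" and "q2 = length cm"
  note len = q1_def q2_def
  have onesP: "\<And>b. b \<in> set (cp @ cm) \<Longrightarrow> fst (snd b) = 1" using cp cm by auto
  have lenP: "q1 + q2 = q" using blocks_of_size_one(1)[OF onesP] sz by (simp add: len)
  define a where "a = (\<lambda>i. fst ((cp @ cm) ! i))"
  have "Sinv * A * S = mat q q (\<lambda>(i, j). if i = j then a i else 0)"
  proof -
    have "jblocks (cp @ cm) = mat (length (cp @ cm)) (length (cp @ cm)) (\<lambda>(i, j). if i = j then fst ((cp @ cm) ! i) else 0)"
      by (rule blocks_of_size_one(2)) (rule onesP)
    moreover have "length (cp @ cm) = q" using lenP by (simp add: len)
    ultimately show ?thesis by (simp only: AP a_def)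
  qed
  from square_eigenvalue_matching[OF A sq S inv this]
  obtain \<pi> where bij: "bij_betw \<pi> {..<q} {..<q}"
    and \<pi>: "\<And>i. i < q \<Longrightarrow> a i * a i = complex_of_real (lam (\<pi> i))" by blast
  have root: "j < q \<Longrightarrow> complex_of_real (sqrt (lam j)) * complex_of_real (sqrt (lam j)) = complex_of_real (lam j)" for j
    using lam[of j] by (simp flip: of_real_mult add: less_imp_le)
  have cp_map: "cp = map (\<lambda>i. (complex_of_real (sqrt (lam (\<pi> i))), 1, 1)) [0..<q1]"
    unfolding q1_def
  proof (rule list_eq_map_upt)
    fix i assume i: "i < length cp"
    then have "cp ! i \<in> (\<lambda>i. (complex_of_real (sqrt (lam i)), 1, 1)) ` {..<q}" using cp nth_mem by blast
    then obtain j where j: "j < q" "cp ! i = (complex_of_real (sqrt (lam j)), 1, 1)" by blast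
    have "i < q" using i lenP by (simp add: len)
    from \<pi>[OF this] have "lam j = lam (\<pi> i)" using j i by (simp add: a_def nth_append root)
    then show "cp ! i = (complex_of_real (sqrt (lam (\<pi> i))), 1, 1)" using j by simp
  qed
  have cm_map: "cm = map (\<lambda>i. (- complex_of_real (sqrt (lam (\<pi> (q1 + i)))), 1, 1)) [0..<q2]"
    unfolding q2_def
  proof (rule list_eq_map_upt)
    fix i assume i: "i < length cm"
    then have "cm ! i \<in> (\<lambda>i. (- complex_of_real (sqrt (lam i)), 1, 1)) ` {..<q}" using cm nth_mem by blast
    then obtain j where j: "j < q" "cm ! i = (- complex_of_real (sqrt (lam j)), 1, 1)" by blast
    have "q1 + i < q" using i lenP by (simp add: len)
    from \<pi>[OF this] have "lam j = lam (\<pi> (q1 + i))" using j i by (simp add: a_def nth_append root q1_def)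
    then show "cm ! i = (- complex_of_real (sqrt (lam (\<pi> (q1 + i)))), 1, 1)" using j by simp
  qed

  have "mat_adjoint S * 1\<^sub>m q * S = gblocks (cp @ cm)" using can by (simp add: P.canon_def)
  with lenP bij S inv AP show thesis using that[of q1 q2 \<pi> S Sinv] unfolding cp_map[symmetric] cm_map[symmetric] by blast
qed

text \<open>The canonical form of the root on the part at \<open>0\<close>, with the numbers of blocks determined by kernel
  dimensions and the signs of the blocks of size \<open>1\<close> by inertia.\<close>

theorem nilpotent_part:
  fixes A :: "complex mat" and eps :: "nat \<Rightarrow> complex" and s t :: nat
  defines "bs \<equiv> null_blocks eps s t" and "m \<equiv> s + 2 * t"
  assumes eps: "\<And>i. i < s \<Longrightarrow> eps i = 1 \<or> eps i = -1"
    and A [simp]: "A \<in> carrier_mat m m" and self: "gblocks bs * A = mat_adjoint A * gblocks bs"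
    and sq: "A * A = jblocks bs"
    and nonneg: "\<And>x. x \<in> carrier_vec m \<Longrightarrow> 0 \<le> indef_prod (gblocks bs) (jblocks bs *\<^sub>v x) x"
  obtains l1 l2 \<zeta> \<eta> \<iota> S Sinv where "l1 + 2 * l2 + t = s"
    "\<forall>i<l2. \<eta> i = 1 \<or> \<eta> i = -1"
    "inj_on \<iota> {..<l1}" "\<iota> ` {..<l1} \<subseteq> {..<s}" "\<forall>i<l1. \<zeta> i = eps (\<iota> i)"
    "S \<in> carrier_mat m m" "Sinv \<in> carrier_mat m m" "S * Sinv = 1\<^sub>m m" "Sinv * S = 1\<^sub>m m"
    "Sinv * A * S = jblocks (map (\<lambda>i. (0, 1, \<zeta> i)) [0..<l1] @ map (\<lambda>i. (0, 2, \<eta> i)) [0..<l2] @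
       map (\<lambda>i. (0, 3, 1)) [0..<t])"
    "mat_adjoint S * gblocks bs * S = gblocks (map (\<lambda>i. (0, 1, \<zeta> i)) [0..<l1] @
       map (\<lambda>i. (0, 2, \<eta> i)) [0..<l2] @ map (\<lambda>i. (0, 3, 1)) [0..<t])"
proof -
  let ?N = "jblocks bs" and ?H = "gblocks bs"
  have "\<forall>i<s. eps i = 1 \<or> eps i = -1" using eps by blast
  then have sg: "signed bs" by (auto simp: bs_def null_blocks_def signed_def)
  have size: "bsize bs = m" by (simp add: bs_def m_def null_blocks)
  have NH [simp]: "?N \<in> carrier_mat m m" "?H \<in> carrier_mat m m"
    using size by (metis jblocks_carrier gblocks_carrier)+
  have NN: "?N * ?N = 0\<^sub>m m m" unfolding bs_def m_def by (rule null_blocks_square_zero)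
  interpret Z: selfadjoint_pair m ?H A
    by unfold_locales (use gblocks_hermitian[OF sg] gblocks_square[OF sg] size self in \<open>auto intro!: bexI[of _ ?H]\<close>)
  have AA: "A *\<^sub>v (A *\<^sub>v x) = ?N *\<^sub>v x" if "x \<in> carrier_vec m" for x
    unfolding sq[symmetric] by (rule assoc_mult_mat_vec[OF A A that, symmetric])
  have pos: "0 \<le> indef_prod ?H (A *\<^sub>v (A *\<^sub>v x)) x" if x: "x \<in> carrier_vec m" for x
    using nonneg[OF x] AA[OF x] by simp
  have nil: "A *\<^sub>v (A *\<^sub>v (A *\<^sub>v (A *\<^sub>v x))) = 0\<^sub>v m" if x: "x \<in> carrier_vec m" for x
  proof -
    have "A *\<^sub>v (A *\<^sub>v (A *\<^sub>v (A *\<^sub>v x))) = ?N *\<^sub>v (?N *\<^sub>v x)"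
      using x mult_mat_vec_carrier[OF NH(1) x] by (simp add: AA)
    also have "\<dots> = (?N * ?N) *\<^sub>v x" using x by (simp add: assoc_mult_mat_vec[OF NH(1,1)])
    also have "\<dots> = 0\<^sub>v m" unfolding NN using x by (auto intro!: eq_vecI)
    finally show ?thesis .
  qed

  obtain cs1 cs2 cs3 S where cs1: "set cs1 \<subseteq> {(0, 1, 1), (0, 1, -1)}"
    and cs2: "set cs2 \<subseteq> {(0, 2, 1), (0, 2, -1)}" and cs3: "set cs3 \<subseteq> {(0, 3, 1)}"
    and can: "Z.canon (cs1 @ cs2 @ cs3) S" and triv: "Z.orth S \<subseteq> {0\<^sub>v m}"
    using Z.nilpotent_canonical[OF pos nil] by blast
  have sgS: "signed (cs1 @ cs2 @ cs3)" using cs1 cs2 cs3 by (auto simp: signed_def)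
  obtain Sinv where sz: "bsize (cs1 @ cs2 @ cs3) = m" and S [simp]: "S \<in> carrier_mat m m" "Sinv \<in> carrier_mat m m"
    and inv: "S * Sinv = 1\<^sub>m m" "Sinv * S = 1\<^sub>m m" and AS0: "Sinv * A * S = jblocks (cs1 @ cs2 @ cs3)"
    using Z.canon_complete[OF can sgS triv] by blast

  define l1 l2 l3 where "l1 = length cs1" and "l2 = length cs2" and "l3 = length cs3"
  note len = l1_def l2_def l3_def
  define \<zeta> where "\<zeta> = (\<lambda>i. snd (snd (cs1 ! i)))"
  define \<eta> where "\<eta> = (\<lambda>i. snd (snd (cs2 ! i)))"
  have z1: "cs1 ! i = (0, 1, \<zeta> i) \<and> (\<zeta> i = 1 \<or> \<zeta> i = -1)" if "i < l1" for i
    using subsetD[OF cs1 nth_mem, of i] that by (auto simp: \<zeta>_def l1_def)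
  have e1: "cs2 ! i = (0, 2, \<eta> i) \<and> (\<eta> i = 1 \<or> \<eta> i = -1)" if "i < l2" for i
    using subsetD[OF cs2 nth_mem, of i] that by (auto simp: \<eta>_def l2_def)
  have cs1_map: "cs1 = map (\<lambda>i. (0, 1, \<zeta> i)) [0..<l1]"
    unfolding l1_def by (rule list_eq_map_upt) (use z1 in \<open>simp add: l1_def\<close>)
  have cs2_map: "cs2 = map (\<lambda>i. (0, 2, \<eta> i)) [0..<l2]"
    unfolding l2_def by (rule list_eq_map_upt) (use e1 in \<open>simp add: l2_def\<close>)
  have cs3_map: "cs3 = map (\<lambda>i. (0, 3, 1)) [0..<l3]"
    unfolding l3_def by (rule list_eq_map_upt) (use subsetD[OF cs3 nth_mem] in auto)

  have size1: "bsize cs1 = l1" unfolding cs1_map by (subst blocks_of_size_one) auto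
  have size2: "bsize cs2 = 2 * l2" unfolding cs2_map bsize_def by (simp add: comp_def sum_list_triv)
  have size3: "bsize cs3 = 3 * l3" unfolding cs3_map bsize_def by (simp add: comp_def sum_list_triv)
  have dims: "l1 + 2 * l2 + 3 * l3 = s + 2 * t"
    using sz size1 size2 size3 by (simp add: m_def)

  have nfA: "jordan_nf A (map (\<lambda>(a, k, \<theta>). (k, a)) (cs1 @ cs2 @ cs3))"
    by (rule jordan_nf_jblocks[OF sgS A S inv AS0])
  have nfN: "jordan_nf ?N (map (\<lambda>(a, k, \<theta>). (k, a)) bs)"
  proof (rule jordan_nf_jblocks[OF sg NH(1)])
    show "1\<^sub>m m * ?N * 1\<^sub>m m = ?N"
      unfolding left_mult_one_mat[OF NH(1)] right_mult_one_mat[OF NH(1)] by (rule refl)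
  qed auto
  \<comment> \<open>The left side counts \<open>ker A\<^sup>2\<close> in the Jordan form of \<open>A\<close>, the right side counts it as the kernel
    of the given matrix.  Together with the dimension formula this forces \<open>l3 = t\<close>.\<close>
  have counts: "l1 + 2 * l2 + 2 * l3 = s + t"
    using square_root_block_counts[OF A sq[symmetric] nfA nfN]
    unfolding cs1_map cs2_map cs3_map bs_def null_blocks_def
    by (simp add: comp_def sum_list_triv filter_map sum_list_replicate)
  have l3: "l3 = t" and ls: "l1 + 2 * l2 + l3 = s" using dims counts by auto

  have AS: "A * S = S * jblocks (cs1 @ cs2 @ cs3)" and HS: "mat_adjoint S * ?H * S = gblocks (cs1 @ cs2 @ cs3)"
    using can by (auto simp: Z.canon_def)
  have l1m: "l1 \<le> m" using sz size1 by simp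
  have ones1: "\<And>b. b \<in> set cs1 \<Longrightarrow> fst (snd b) = 1" using cs1 by auto
  have colS: "col S i \<in> carrier_vec m" for i
    by (metis S(1) carrier_matD(1) col_dim)
  \<comment> \<open>The generators of the blocks of size \<open>1\<close> are the first \<open>l1\<close> columns of \<open>S\<close>.\<close>
  have ker: "?N *\<^sub>v col S i = 0\<^sub>v m" if i: "i < l1" for i
  proof -
    have "col (jblocks (cs1 @ cs2 @ cs3)) i = 0\<^sub>v m"
    proof (rule eq_vecI)
      fix k assume "k < dim_vec (0\<^sub>v m :: complex vec)"
      then have "k < m" by simp
      then show "col (jblocks (cs1 @ cs2 @ cs3)) i $ k = 0\<^sub>v m $ k"
        using i l1m sz size1 z1[OF i] by (auto simp: jblocks_append blocks_of_size_one(2)[OF ones1] len)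
    qed (use sz in simp)
    moreover have "col (A * S) i = A *\<^sub>v col S i"
      using i l1m by (intro col_mult2[OF A S(1)]) simp
    moreover have "col (S * jblocks (cs1 @ cs2 @ cs3)) i = S *\<^sub>v col (jblocks (cs1 @ cs2 @ cs3)) i"
      using i l1m sz by (intro col_mult2[OF S(1), of _ m]) auto
    ultimately have "A *\<^sub>v col S i = 0\<^sub>v m" unfolding AS by (simp add: mult_mat_vec_null[OF S(1)])
    then show ?thesis using AA[OF colS, of i] by (simp add: mult_mat_vec_null[OF A])
  qed
  have gram: "(\<Sum>j\<in>{..<s}. eps j * (col S i $ j) * cnj (col S i' $ j)) = (if i = i' then \<zeta> i else 0)"
    if i: "i \<in> {..<l1}" "i' \<in> {..<l1}" for i i'
  proof -
    have "(\<Sum>j\<in>{..<s}. eps j * (col S i $ j) * cnj (col S i' $ j)) = indef_prod ?H (col S i) (col S i')"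
      unfolding bs_def using form_on_kernel[of "col S i" s t eps "col S i'"] colS ker i
      by (simp add: bs_def m_def)
    also have "\<dots> = gblocks (cs1 @ cs2 @ cs3) $$ (i', i)"
      unfolding HS[symmetric] using i l1m by (subst Z.gram_index[OF S(1) S(1)]) auto
    also have "\<dots> = (if i = i' then \<zeta> i else 0)"
      using i size1 by (auto simp: gblocks_append blocks_of_size_one(3)[OF ones1] len \<zeta>_def)
    finally show ?thesis .
  qed
  have eps': "eps j = 1 \<or> eps j = -1" if "j \<in> {..<s}" for j using eps that by simp
  have zeta': "\<zeta> i = 1 \<or> \<zeta> i = -1" if "i \<in> {..<l1}" for i using z1[of i] that by simp
  obtain \<iota> where iota: "inj_on \<iota> {..<l1}" "\<iota> ` {..<l1} \<subseteq> {..<s}" "\<And>i. i \<in> {..<l1} \<Longrightarrow> \<zeta> i = eps (\<iota> i)"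
    using inertia_injection[OF finite_lessThan finite_lessThan eps' zeta' gram] by blast
  have "Sinv * A * S = jblocks (map (\<lambda>i. (0, 1, \<zeta> i)) [0..<l1] @ map (\<lambda>i. (0, 2, \<eta> i)) [0..<l2] @
       map (\<lambda>i. (0, 3, 1)) [0..<t])"
    "mat_adjoint S * ?H * S = gblocks (map (\<lambda>i. (0, 1, \<zeta> i)) [0..<l1] @
       map (\<lambda>i. (0, 2, \<eta> i)) [0..<l2] @ map (\<lambda>i. (0, 3, 1)) [0..<t])"
    unfolding AS0 HS cs1_map[symmetric] cs2_map[symmetric] cs3_map[unfolded l3, symmetric] by (rule refl)+
  moreover have "l1 + 2 * l2 + t = s" using ls l3 by simp
  ultimately show thesis
    using that[of l1 l2 \<eta> \<iota> \<zeta> S Sinv] e1 iota S inv by simp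
qed

theorem theorem4p4:
  fixes n q s t :: nat
    and H B A :: "complex mat"
    and lam :: "nat \<Rightarrow> real"
    and eps :: "nat \<Rightarrow> complex"
  assumes "H \<in> carrier_mat n n" and "invertible_mat H" and "hermitian_mat H"
    and "B \<in> carrier_mat n n" and "H_nonnegative n H B"
    and "spectrum B \<subseteq> complex_of_real ` {0..}"
    and "B = diag_block_mat
          (map (\<lambda>i. jordan_block 1 (complex_of_real (lam i))) [0..<q] @
           map (\<lambda>i. jordan_block 1 0) [0..<s] @
           map (\<lambda>i. jordan_block 2 0) [0..<t])"
    and "H = diag_block_mat
          (map (\<lambda>i. sip_mat 1) [0..<q] @
           map (\<lambda>i. eps i \<cdot>\<^sub>m sip_mat 1) [0..<s] @
           map (\<lambda>i. sip_mat 2) [0..<t])"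
    and "\<forall>i<q. lam i > 0"
    and "\<forall>i<s. eps i = 1 \<or> eps i = -1"
    and "card {i. i < s \<and> eps i = 1} \<ge> t"
    and "A \<in> carrier_mat n n" and "H_selfadjoint H A" and "A * A = B"
  shows "\<exists>P l1 l2 l3 q1 q2 \<pi> \<zeta> \<eta> \<iota> S Sinv.
      segre_pairing B P \<and>
      P = replicate_mset l1 (1, 0) + replicate_mset l2 (1, 1) + replicate_mset l3 (2, 1) \<and>
      q1 + q2 = q \<and>
      bij_betw \<pi> {..<q} {..<q} \<and>
      (\<forall>i<l2. \<eta> i = 1 \<or> \<eta> i = -1) \<and>
      inj_on \<iota> {..<l1} \<and> \<iota> ` {..<l1} \<subseteq> {..<s} \<and>
      (\<forall>i<l1. \<zeta> i = eps (\<iota> i)) \<and>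
      S \<in> carrier_mat n n \<and> Sinv \<in> carrier_mat n n \<and>
      inverts_mat S Sinv \<and> inverts_mat Sinv S \<and>
      Sinv * A * S = diag_block_mat
        (map (\<lambda>i. jordan_block 1 (complex_of_real (sqrt (lam (\<pi> i))))) [0..<q1] @
         map (\<lambda>i. jordan_block 1 (- complex_of_real (sqrt (lam (\<pi> (q1 + i)))))) [0..<q2] @
         map (\<lambda>i. jordan_block 1 0) [0..<l1] @
         map (\<lambda>i. jordan_block 2 0) [0..<l2] @
         map (\<lambda>i. jordan_block 3 0) [0..<l3]) \<and>
      mat_adjoint S * H * S = diag_block_mat
        (map (\<lambda>i. sip_mat 1) [0..<q1] @
         map (\<lambda>i. sip_mat 1) [0..<q2] @
         map (\<lambda>i. \<zeta> i \<cdot>\<^sub>m sip_mat 1) [0..<l1] @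
         map (\<lambda>i. \<eta> i \<cdot>\<^sub>m sip_mat 2) [0..<l2] @
         map (\<lambda>i. sip_mat 3) [0..<l3])"
proof -
  define m where "m = s + 2 * t"
  let ?bp = "map (\<lambda>i. (complex_of_real (lam i), 1, 1)) [0..<q] :: block list"
  let ?D = "mat q q (\<lambda>(i, j). if i = j then complex_of_real (lam i) else 0)"
  let ?N = "jblocks (null_blocks eps s t)" and ?H = "gblocks (null_blocks eps s t)"
  have bp: "bsize ?bp = q" "jblocks ?bp = ?D" "gblocks ?bp = 1\<^sub>m q"
    by (subst blocks_of_size_one; auto intro!: eq_matI)+
  have size: "bsize (null_blocks eps s t) = m" by (simp add: m_def null_blocks)
  have eps: "eps i = 1 \<or> eps i = -1" if "i < s" for i using assms(10) that by simp
  have sg: "signed (?bp @ null_blocks eps s t)"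
    using assms(10) by (auto simp: signed_def null_blocks_def)
  have NH [simp]: "?N \<in> carrier_mat m m" "?H \<in> carrier_mat m m"
    using size by (metis jblocks_carrier gblocks_carrier)+
  have Be: "B = jblocks (?bp @ null_blocks eps s t)"
    unfolding assms(7) jblocks_def null_blocks_def by (simp add: comp_def map_replicate_const)
  have He: "H = gblocks (?bp @ null_blocks eps s t)"
    unfolding assms(8) gblocks_def null_blocks_def by (simp add: comp_def map_replicate_const one_smult)
  have B: "B = four_block_mat ?D (0\<^sub>m q m) (0\<^sub>m m q) ?N"
    unfolding Be jblocks_append bp size ..
  have H: "H = four_block_mat (1\<^sub>m q) (0\<^sub>m q m) (0\<^sub>m m q) ?H"
    unfolding He gblocks_append bp size ..
  have n: "n = q + m"
    using carrier_matD(1)[OF assms(4)] carrier_matD(1)[OF NH(1)] unfolding B by simp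
  have A: "A \<in> carrier_mat (q + m) (q + m)" using assms(12) n by simp
  have D: "?D \<in> carrier_mat q q" by simp

  \<comment> \<open>A square root commutes with its square, and the two diagonal parts of the square have
    disjoint spectra.\<close>
  have "A * B = B * A"
    unfolding assms(14)[symmetric] using assms(12) by (simp add: assoc_mult_mat[of A n n A n A n])
  then obtain A1 A4 where A14 [simp]: "A1 \<in> carrier_mat q q" "A4 \<in> carrier_mat m m"
    and Ae: "A = four_block_mat A1 (0\<^sub>m q m) (0\<^sub>m m q) A4"
    using commutant_block_diagonal[OF A NH(1) null_blocks_square_zero[of eps s t, folded m_def],
        of "\<lambda>i. complex_of_real (lam i)"] assms(9)
    unfolding B by (metis of_real_eq_0_iff less_irrefl)
  have prods: "A1 * A1 \<in> carrier_mat q q" "A4 * A4 \<in> carrier_mat m m"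
    "?H * A4 \<in> carrier_mat m m" "mat_adjoint A4 * ?H \<in> carrier_mat m m"
    by (auto intro: mult_carrier_mat[of _ q q] mult_carrier_mat[of _ m m])
  have "four_block_mat (A1 * A1) (0\<^sub>m q m) (0\<^sub>m m q) (A4 * A4) = four_block_mat ?D (0\<^sub>m q m) (0\<^sub>m m q) ?N"
    using assms(14) unfolding Ae B by (simp add: block_diag_mult)
  from four_block_inject[OF _ _ _ _ _ _ _ _ this, of q q m m]
  have sq1: "A1 * A1 = ?D" and sq4: "A4 * A4 = ?N" using prods by simp_all
  have "four_block_mat A1 (0\<^sub>m q m) (0\<^sub>m m q) (?H * A4)
    = four_block_mat (mat_adjoint A1) (0\<^sub>m q m) (0\<^sub>m m q) (mat_adjoint A4 * ?H)"
    using assms(13) unfolding H_selfadjoint_def Ae H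
    by (simp add: block_diag_mult block_diag_adjoint left_mult_one_mat[OF A14(1)]
        right_mult_one_mat[OF adjoint_carrier[OF A14(1)]])
  from four_block_inject[OF _ _ _ _ _ _ _ _ this, of q q m m]
  have adj1: "mat_adjoint A1 = A1" and self4: "?H * A4 = mat_adjoint A4 * ?H" using prods by auto
  have nonneg: "0 \<le> indef_prod ?H (?N *\<^sub>v x) x" if x: "x \<in> carrier_vec m" for x
  proof -
    have Nx: "?N *\<^sub>v x \<in> carrier_vec m" using x by (auto intro: mult_mat_vec_carrier[OF NH(1)])
    have HNx: "?H *\<^sub>v (?N *\<^sub>v x) \<in> carrier_vec m"
      by (rule mult_mat_vec_carrier[OF NH(2) Nx])
    have "B *\<^sub>v (0\<^sub>v q @\<^sub>v x) = 0\<^sub>v q @\<^sub>v (?N *\<^sub>v x)"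
      unfolding B using x by (simp add: block_diag_vec mult_mat_vec_null[OF D])
    then have "H *\<^sub>v (B *\<^sub>v (0\<^sub>v q @\<^sub>v x)) = 0\<^sub>v q @\<^sub>v (?H *\<^sub>v (?N *\<^sub>v x))"
      unfolding H using Nx by (simp add: block_diag_vec)
    then have "indef_prod H (B *\<^sub>v (0\<^sub>v q @\<^sub>v x)) (0\<^sub>v q @\<^sub>v x) = indef_prod ?H (?N *\<^sub>v x) x"
      unfolding indef_prod_def using x HNx by (simp add: cscalar_append[of _ q _ _ m])
    moreover have "0\<^sub>v q @\<^sub>v x \<in> carrier_vec n" using x n by simp
    ultimately show ?thesis using assms(5) by (metis H_nonnegative_def)
  qed

  obtain \<pi> q1 q2 Sp Spi where lenP: "q1 + q2 = q" and bij: "bij_betw \<pi> {..<q} {..<q}"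
    and Sp [simp]: "Sp \<in> carrier_mat q q" "Spi \<in> carrier_mat q q"
    and invP: "Sp * Spi = 1\<^sub>m q" "Spi * Sp = 1\<^sub>m q"
    and AP: "Spi * A1 * Sp = jblocks (map (\<lambda>i. (complex_of_real (sqrt (lam (\<pi> i))), 1, 1)) [0..<q1] @
       map (\<lambda>i. (- complex_of_real (sqrt (lam (\<pi> (q1 + i)))), 1, 1)) [0..<q2])"
    and HP: "mat_adjoint Sp * 1\<^sub>m q * Sp = gblocks (map (\<lambda>i. (complex_of_real (sqrt (lam (\<pi> i))), 1, 1)) [0..<q1] @
       map (\<lambda>i. (- complex_of_real (sqrt (lam (\<pi> (q1 + i)))), 1, 1)) [0..<q2])"
    by (rule positive_part[OF A14(1) adj1 sq1 assms(9)[rule_format]])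
  obtain l1 l2 \<zeta> \<eta> \<iota> S0 S0i where ls: "l1 + 2 * l2 + t = s"
    and eta: "\<forall>i<l2. \<eta> i = 1 \<or> \<eta> i = -1"
    and iota: "inj_on \<iota> {..<l1}" "\<iota> ` {..<l1} \<subseteq> {..<s}" "\<forall>i<l1. \<zeta> i = eps (\<iota> i)"
    and S0 [simp]: "S0 \<in> carrier_mat m m" "S0i \<in> carrier_mat m m"
    and invZ: "S0 * S0i = 1\<^sub>m m" "S0i * S0 = 1\<^sub>m m"
    and AZ: "S0i * A4 * S0 = jblocks (map (\<lambda>i. (0, 1, \<zeta> i)) [0..<l1] @ map (\<lambda>i. (0, 2, \<eta> i)) [0..<l2] @
       map (\<lambda>i. (0, 3, 1)) [0..<t])"
    and HZ: "mat_adjoint S0 * ?H * S0 = gblocks (map (\<lambda>i. (0, 1, \<zeta> i)) [0..<l1] @ map (\<lambda>i. (0, 2, \<eta> i)) [0..<l2] @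
       map (\<lambda>i. (0, 3, 1)) [0..<t])"
    by (rule nilpotent_part[of s eps A4 t, folded m_def, OF eps A14(2) self4 sq4 nonneg])

  have nfB: "jordan_nf B (map (\<lambda>(a, k, \<theta>). (k, a)) (?bp @ null_blocks eps s t))"
  proof (rule jordan_nf_jblocks[OF sg assms(4)])
    show "1\<^sub>m n * B * 1\<^sub>m n = jblocks (?bp @ null_blocks eps s t)"
      unfolding left_mult_one_mat[OF assms(4)] right_mult_one_mat[OF assms(4)] by (rule Be)
  qed auto
  have zero_blocks: "filter (\<lambda>(k, a). a = 0) (map (\<lambda>(a, k, \<theta>). (k, a)) (?bp @ null_blocks eps s t))
      = replicate s (1, 0) @ replicate t (2, 0)"
    using assms(9) by (auto simp: null_blocks_def filter_map comp_def map_replicate_const filter_empty_conv)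
  have segre: "segre_pairing B (replicate_mset l1 (1, 0) + replicate_mset l2 (1, 1) + replicate_mset t (2, 1))"
    by (rule segre_pairing_of_counts[OF nfB], unfold zero_blocks) (simp add: ls[symmetric])

  let ?cp = "map (\<lambda>i. (complex_of_real (sqrt (lam (\<pi> i))), 1, 1)) [0..<q1] @
       map (\<lambda>i. (- complex_of_real (sqrt (lam (\<pi> (q1 + i)))), 1, 1)) [0..<q2] :: block list"
  let ?cs = "map (\<lambda>i. (0, 1, \<zeta> i)) [0..<l1] @ map (\<lambda>i. (0, 2, \<eta> i)) [0..<l2] @
       map (\<lambda>i. (0, 3, 1)) [0..<t] :: block list"
  have szP: "bsize ?cp = q"
    using lenP by (subst blocks_of_size_one) auto
  have szZ: "bsize ?cs = m"
    using ls by (simp add: m_def bsize_def comp_def sum_list_triv)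
  define S where "S = four_block_mat Sp (0\<^sub>m q m) (0\<^sub>m m q) S0"
  define Sinv where "Sinv = four_block_mat Spi (0\<^sub>m q m) (0\<^sub>m m q) S0i"
  have S: "S \<in> carrier_mat n n" "Sinv \<in> carrier_mat n n" by (simp_all add: S_def Sinv_def n)
  have inv: "inverts_mat S Sinv" "inverts_mat Sinv S"
    unfolding inverts_mat_def S_def Sinv_def
    using carrier_matD(1)[OF Sp(1)] carrier_matD(1)[OF Sp(2)] carrier_matD(1)[OF S0(1)] carrier_matD(1)[OF S0(2)]
    by (simp_all add: block_diag_mult invP invZ)
  have cP: "Spi * A1 \<in> carrier_mat q q" "mat_adjoint Sp * 1\<^sub>m q \<in> carrier_mat q q"
    by (auto intro!: mult_carrier_mat[of _ q q])
  have cZ: "S0i * A4 \<in> carrier_mat m m" "mat_adjoint S0 * ?H \<in> carrier_mat m m"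
    by (auto intro!: mult_carrier_mat[of _ m m])
  have "Sinv * A * S = four_block_mat (jblocks ?cp) (0\<^sub>m q m) (0\<^sub>m m q) (jblocks ?cs)"
    unfolding S_def Sinv_def Ae AP[symmetric] AZ[symmetric] using cP cZ by (simp add: block_diag_mult)
  also have "\<dots> = jblocks (?cp @ ?cs)"
    unfolding jblocks_append[of ?cp] szP szZ ..
  also have "\<dots> = diag_block_mat
        (map (\<lambda>i. jordan_block 1 (complex_of_real (sqrt (lam (\<pi> i))))) [0..<q1] @
         map (\<lambda>i. jordan_block 1 (- complex_of_real (sqrt (lam (\<pi> (q1 + i)))))) [0..<q2] @
         map (\<lambda>i. jordan_block 1 0) [0..<l1] @
         map (\<lambda>i. jordan_block 2 0) [0..<l2] @
         map (\<lambda>i. jordan_block 3 0) [0..<t])"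
    unfolding jblocks_def by (simp add: comp_def)
  finally have resA: "Sinv * A * S = \<dots>" .
  have "mat_adjoint S * H * S = four_block_mat (gblocks ?cp) (0\<^sub>m q m) (0\<^sub>m m q) (gblocks ?cs)"
    unfolding S_def H HP[symmetric] HZ[symmetric] using cP cZ by (simp add: block_diag_mult block_diag_adjoint)
  also have "\<dots> = gblocks (?cp @ ?cs)"
    unfolding gblocks_append[of ?cp] szP szZ ..
  also have "\<dots> = diag_block_mat
        (map (\<lambda>i. sip_mat 1) [0..<q1] @
         map (\<lambda>i. sip_mat 1) [0..<q2] @
         map (\<lambda>i. \<zeta> i \<cdot>\<^sub>m sip_mat 1) [0..<l1] @
         map (\<lambda>i. \<eta> i \<cdot>\<^sub>m sip_mat 2) [0..<l2] @
         map (\<lambda>i. sip_mat 3) [0..<t])"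
    unfolding gblocks_def by (simp add: comp_def one_smult)
  finally have resH: "mat_adjoint S * H * S = \<dots>" .
  show ?thesis
    by (rule exI[of _ "replicate_mset l1 (1, 0) + replicate_mset l2 (1, 1) + replicate_mset t (2, 1)"],
        rule exI[of _ l1], rule exI[of _ l2], rule exI[of _ t], rule exI[of _ q1], rule exI[of _ q2],
        rule exI[of _ \<pi>], rule exI[of _ \<zeta>], rule exI[of _ \<eta>], rule exI[of _ \<iota>],
        rule exI[of _ S], rule exI[of _ Sinv])
      (intro conjI segre refl lenP bij S inv iota eta resA resH)
qed

end
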